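(* Let $p\in(1,2]$ be such that, with $1/p+1/p^\ast=1$, $L^{p^\ast}(\Omega;\mathbb{R}^{d\times d})$ possesses a (row-wise) Helmholtz decomposition. Assume that $K(u_\Omega,y_\Omega)\in L^p(\Omega;\mathbb{R}^{d\times d})$, $f\in L^\infty(\Omega)$ and $j(u_\Omega)\in L^2(\Omega)$, and that the compatibility condition $(f\,\nabla y_\Omega,e)=0$ holds for all constant $e\in\mathbb{R}^d$. Let $(S,\theta)\in\Sigma^{p,0}\times W^{1,p^\ast}(\Omega;\mathbb{R}^d)$ be a solution of $$\begin{aligned}(|S-K(u_\Omega,y_\Omega)|^{p-2}(S-K(u_\Omega,y_\Omega)),T)+(\mathrm{div}\,T,\theta)&=0,\\(\mathrm{div}\,S,\chi)-(f\,\nabla y_\Omega,\chi)-(j(u_\Omega),\mathrm{div}\,\chi)&=0\end{aligned}$$ for all $T\in\Sigma^{p,0}$ and $\chi\in W^{1,p^\ast}(\Omega;\mathbb{R}^d)$. Then the Lagrange multiplier $\theta$ satisfies $$-\frac{J'(\Omega)[\theta]}{\|\nabla\theta\|_{L^{p^\ast}(\Omega;\mathbb{R}^{d\times d})}}=\sup_{\chi\in W^{1,p^\ast}(\Omega;\mathbb{R}^d)}\frac{J'(\Omega)[\chi]}{\|\nabla\chi\|_{L^{p^\ast}(\Omega;\mathbb{R}^{d\times d})}}=\eta_p(\Omega).$$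
   Context: $\Omega\subset\mathbb{R}^d$ ($d=2$ or $3$) is a bounded Lipschitz domain. $j$ is a differentiable real function with $j(u)\in L^1(\Omega)$ and $j'(u)\in L^2(\Omega)$ for all $u\in H_0^1(\Omega)$. $(\cdot,\cdot)$ denotes the duality pairing between $L^p(\Omega)$ and $L^{p^\ast}(\Omega)$ (for scalar, vector or matrix functions). $|\cdot|$ is the Euclidean (Frobenius) norm, and $|M|^{p-2}M$ is read as $0$ where $M=0$. The state $u_\Omega\in H_0^1(\Omega)$ solves $(\nabla u_\Omega,\nabla v)=(f,v)$ for all $v\in H_0^1(\Omega)$. The adjoint state $y_\Omega\in H_0^1(\Omega)$ solves $(\nabla y_\Omega,\nabla z)=-(j'(u_\Omega),z)$ for all $z\in H_0^1(\Omega)$. Gradients of scalar functions are column vectors; for vector functions each row of the gradient is the gradient of a component; the divergence of a matrix function is taken row-wise. The Sturm-Laurain shape tensor is $$K(u_\Omega,y_\Omega)=(\nabla u_\Omega\cdot\nabla y_\Omega)\,I-\nabla y_\Omega\otimes\nabla u_\Omega-\nabla u_\Omega\otimes\nabla y_\Omega .$$ The shape derivative of the shape functional $J(\Omega)=\int_\Omega j(u_\Omega)\,dx$ in direction $\chi$ is given by $$J'(\Omega)[\chi]=(K(u_\Omega,y_\Omega),\nabla\chi)+(f\,\nabla y_\Omega,\chi)+(j(u_\Omega),\mathrm{div}\,\chi),$$ and this expression is taken as the definition of $J'(\Omega)$ as a functional on $W^{1,p^\ast}(\Omega;\mathbb{R}^d)$. Define $\Sigma^p=\{T\in L^p(\Omega;\mathbb{R}^{d\times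 d}):\mathrm{div}\,T\in L^p(\Omega;\mathbb{R}^d)\}$ and $\Sigma^{p,0}=\{T\in\Sigma^p:\langle T\cdot n,\chi|_{\partial\Omega}\rangle=0\text{ for all }\chi\in W^{1,p^\ast}(\Omega;\mathbb{R}^d)\}$, where $\langle\cdot,\cdot\rangle$ is the duality pairing on $\partial\Omega$ and $n$ the outward unit normal. Further $$\eta_p(\Omega)=\inf\{\|T-K(u_\Omega,y_\Omega)\|_{L^p(\Omega)}:T\in\Sigma^{p,0},\ (\mathrm{div}\,T,\chi)=(f\,\nabla y_\Omega,\chi)+(j(u_\Omega),\mathrm{div}\,\chi)\ \forall\chi\in W^{1,p^\ast}(\Omega;\mathbb{R}^d)\}.$$ Helmholtz decomposition: $L^{p^\ast}(\Omega;\mathbb{R}^{d\times d})$ possesses a Helmholtz decomposition if $L^{p^\ast}(\Omega;\mathbb{R}^d)=G_{p^\ast}(\Omega)\oplus H_{p^\ast}(\Omega)$ (applied to each row of a matrix function), where $G_{p^\ast}(\Omega)=\{\nabla\vartheta:\vartheta\in W^{1,p^\ast}(\Omega)\}$ and $H_{p^\ast}(\Omega)$ is the subspace of divergence-free functions in $L^{p^\ast}(\Omega;\mathbb{R}^d)$ with zero normal trace on $\partial\Omega$. The supremum is taken over $\chi$ with $\nabla\chi\neq0$, and the first quotient is understood for $\nabla\theta\neq0$. *)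

theory Defs
  imports "HOL-Analysis.Analysis"
begin

text \<open>
  Functions on a domain \<open>\<Omega>\<close> are represented by total functions on the whole space, of which only
  the values on \<open>\<Omega>\<close> matter; elements of Lebesgue and Sobolev spaces are representatives, not
  equivalence classes.
\<close>

section \<open>Bounded Lipschitz domains\<close>

text \<open>Near every boundary point, \<open>\<Omega>\<close> is the part strictly above the graph, in some direction
  \<open>\<nu>\<close>, of a Lipschitz function on the hyperplane orthogonal to \<open>\<nu>\<close>.\<close>

definition lipschitz_boundary :: "(real^'n) set \<Rightarrow> bool" where
  "lipschitz_boundary \<Omega> \<longleftrightarrow>
     (\<forall>x\<in>frontier \<Omega>. \<exists>\<nu> r L \<gamma>. norm \<nu> = 1 \<and> 0 < r \<and>
        L-lipschitz_on {z. z \<bullet> \<nu> = 0} (\<gamma> :: real^'n \<Rightarrow> real) \<and>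
        \<Omega> \<inter> ball x r = {z \<in> ball x r. \<gamma> (z - (z \<bullet> \<nu>) *\<^sub>R \<nu>) < z \<bullet> \<nu>})"

definition bounded_lipschitz_domain :: "(real^'n) set \<Rightarrow> bool" where
  "bounded_lipschitz_domain \<Omega> \<longleftrightarrow>
     open \<Omega> \<and> connected \<Omega> \<and> \<Omega> \<noteq> {} \<and> bounded \<Omega> \<and> lipschitz_boundary \<Omega>"

section \<open>Lebesgue spaces and the duality pairing\<close>

definition Lp :: "(real^'n) set \<Rightarrow> real \<Rightarrow> (real^'n \<Rightarrow> 'b::euclidean_space) set" where
  "Lp \<Omega> p = {u. u \<in> borel_measurable (lebesgue_on \<Omega>) \<and>
                integrable (lebesgue_on \<Omega>) (\<lambda>x. norm (u x) powr p)}"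

definition Linf :: "(real^'n) set \<Rightarrow> (real^'n \<Rightarrow> 'b::euclidean_space) set" where
  "Linf \<Omega> = {u. u \<in> borel_measurable (lebesgue_on \<Omega>) \<and>
                (\<exists>C. AE x in lebesgue_on \<Omega>. norm (u x) \<le> C)}"

text \<open>On \<open>real^'n^'n\<close> the library's norm and inner product are the Frobenius ones.\<close>

definition Lnorm :: "(real^'n) set \<Rightarrow> real \<Rightarrow> (real^'n \<Rightarrow> 'b::euclidean_space) \<Rightarrow> real" where
  "Lnorm \<Omega> p u = (\<integral>x. norm (u x) powr p \<partial>lebesgue_on \<Omega>) powr (1 / p)"

definition pair ::
  "(real^'n) set \<Rightarrow> (real^'n \<Rightarrow> 'b::euclidean_space) \<Rightarrow> (real^'n \<Rightarrow> 'b) \<Rightarrow> real" where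
  "pair \<Omega> u v = (\<integral>x. u x \<bullet> v x \<partial>lebesgue_on \<Omega>)"

definition loc_integrable :: "(real^'n) set \<Rightarrow> (real^'n \<Rightarrow> 'b::euclidean_space) \<Rightarrow> bool" where
  "loc_integrable \<Omega> u \<longleftrightarrow> (\<forall>C. compact C \<and> C \<subseteq> \<Omega> \<longrightarrow> u absolutely_integrable_on C)"

section \<open>Test functions\<close>

definition classical_grad :: "(real^'n \<Rightarrow> real) \<Rightarrow> real^'n \<Rightarrow> real^'n" where
  "classical_grad \<phi> x = (\<chi> i. frechet_derivative \<phi> (at x) (axis i 1))"

primrec Ck :: "nat \<Rightarrow> (real^'n \<Rightarrow> real) \<Rightarrow> bool" where
  "Ck 0 \<phi> \<longleftrightarrow> continuous_on UNIV \<phi>"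
| "Ck (Suc k) \<phi> \<longleftrightarrow> (\<forall>x. \<phi> differentiable (at x)) \<and> (\<forall>i. Ck k (\<lambda>x. classical_grad \<phi> x $ i))"

definition test_functions :: "(real^'n) set \<Rightarrow> (real^'n \<Rightarrow> real) set" where
  "test_functions \<Omega> =
     {\<phi>. (\<forall>k. Ck k \<phi>) \<and> compact (closure {x. \<phi> x \<noteq> 0}) \<and> closure {x. \<phi> x \<noteq> 0} \<subseteq> \<Omega>}"

section \<open>Weak gradient and weak divergence\<close>

definition has_weak_grad ::
  "(real^'n) set \<Rightarrow> (real^'n \<Rightarrow> real) \<Rightarrow> (real^'n \<Rightarrow> real^'n) \<Rightarrow> bool" where
  "has_weak_grad \<Omega> u g \<longleftrightarrow> loc_integrable \<Omega> u \<and> loc_integrable \<Omega> g \<and>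
     (\<forall>\<phi>\<in>test_functions \<Omega>.
        (\<integral>x. u x *\<^sub>R classical_grad \<phi> x \<partial>lebesgue_on \<Omega>) = - (\<integral>x. \<phi> x *\<^sub>R g x \<partial>lebesgue_on \<Omega>))"

definition has_weak_div ::
  "(real^'n) set \<Rightarrow> (real^'n \<Rightarrow> real^'n) \<Rightarrow> (real^'n \<Rightarrow> real) \<Rightarrow> bool" where
  "has_weak_div \<Omega> v g \<longleftrightarrow> loc_integrable \<Omega> v \<and> loc_integrable \<Omega> g \<and>
     (\<forall>\<phi>\<in>test_functions \<Omega>.
        (\<integral>x. v x \<bullet> classical_grad \<phi> x \<partial>lebesgue_on \<Omega>) = - (\<integral>x. \<phi> x * g x \<partial>lebesgue_on \<Omega>))"

text \<open>Weak gradients and divergences are unique almost everywhere on \<open>\<Omega>\<close>; the following pick a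
  representative and are meaningful only where one exists.\<close>

definition wgrad :: "(real^'n) set \<Rightarrow> (real^'n \<Rightarrow> real) \<Rightarrow> real^'n \<Rightarrow> real^'n" where
  "wgrad \<Omega> u = (SOME g. has_weak_grad \<Omega> u g)"

definition wdiv :: "(real^'n) set \<Rightarrow> (real^'n \<Rightarrow> real^'n) \<Rightarrow> real^'n \<Rightarrow> real" where
  "wdiv \<Omega> v = (SOME g. has_weak_div \<Omega> v g)"

text \<open>\<open>A $ i\<close> is the \<open>i\<close>-th row of the matrix \<open>A\<close>.\<close>

definition wgrad_vec :: "(real^'n) set \<Rightarrow> (real^'n \<Rightarrow> real^'n) \<Rightarrow> real^'n \<Rightarrow> real^'n^'n" where
  "wgrad_vec \<Omega> v x = (\<chi> i. wgrad \<Omega> (\<lambda>z. v z $ i) x)"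

definition wdiv_mat :: "(real^'n) set \<Rightarrow> (real^'n \<Rightarrow> real^'n^'n) \<Rightarrow> real^'n \<Rightarrow> real^'n" where
  "wdiv_mat \<Omega> T x = (\<chi> i. wdiv \<Omega> (\<lambda>z. T z $ i) x)"

section \<open>Sobolev spaces\<close>

definition W1 :: "(real^'n) set \<Rightarrow> real \<Rightarrow> (real^'n \<Rightarrow> real) set" where
  "W1 \<Omega> p = {u \<in> Lp \<Omega> p. \<exists>g\<in>Lp \<Omega> p. has_weak_grad \<Omega> u g}"

definition W1norm :: "(real^'n) set \<Rightarrow> real \<Rightarrow> (real^'n \<Rightarrow> real) \<Rightarrow> real" where
  "W1norm \<Omega> p u = (Lnorm \<Omega> p u powr p + Lnorm \<Omega> p (wgrad \<Omega> u) powr p) powr (1 / p)"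

definition W1_vec :: "(real^'n) set \<Rightarrow> real \<Rightarrow> (real^'n \<Rightarrow> real^'n) set" where
  "W1_vec \<Omega> p = {v. \<forall>i. (\<lambda>x. v x $ i) \<in> W1 \<Omega> p}"

definition H10 :: "(real^'n) set \<Rightarrow> (real^'n \<Rightarrow> real) set" where
  "H10 \<Omega> = {u \<in> W1 \<Omega> 2. \<exists>\<phi>. (\<forall>k::nat. \<phi> k \<in> test_functions \<Omega>) \<and>
                (\<lambda>k. W1norm \<Omega> 2 (\<lambda>x. u x - \<phi> k x)) \<longlonglongrightarrow> 0}"

section \<open>Normal traces and the spaces of matrix fields\<close>

text \<open>The generalized normal trace of a field with exponent \<open>p\<close> and divergence of exponent \<open>p\<close> is
  the functional on boundary values of Sobolev functions of the conjugate exponent which is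
  defined by Green's formula; no pointwise trace exists in general.\<close>

definition normal_trace_vec ::
  "(real^'n) set \<Rightarrow> (real^'n \<Rightarrow> real^'n) \<Rightarrow> (real^'n \<Rightarrow> real) \<Rightarrow> real" where
  "normal_trace_vec \<Omega> v \<xi> = pair \<Omega> (wdiv \<Omega> v) \<xi> + pair \<Omega> v (wgrad \<Omega> \<xi>)"

definition normal_trace_mat ::
  "(real^'n) set \<Rightarrow> (real^'n \<Rightarrow> real^'n^'n) \<Rightarrow> (real^'n \<Rightarrow> real^'n) \<Rightarrow> real" where
  "normal_trace_mat \<Omega> T \<xi> = pair \<Omega> (wdiv_mat \<Omega> T) \<xi> + pair \<Omega> T (wgrad_vec \<Omega> \<xi>)"

definition Sigma_p :: "(real^'n) set \<Rightarrow> real \<Rightarrow> (real^'n \<Rightarrow> real^'n^'n) set" where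
  "Sigma_p \<Omega> p = {T \<in> Lp \<Omega> p. \<forall>i. \<exists>g\<in>Lp \<Omega> p. has_weak_div \<Omega> (\<lambda>x. T x $ i) g}"

definition conj_exp :: "real \<Rightarrow> real" where
  "conj_exp p = p / (p - 1)"

definition Sigma_p0 :: "(real^'n) set \<Rightarrow> real \<Rightarrow> (real^'n \<Rightarrow> real^'n^'n) set" where
  "Sigma_p0 \<Omega> p = {T \<in> Sigma_p \<Omega> p. \<forall>\<xi>\<in>W1_vec \<Omega> (conj_exp p). normal_trace_mat \<Omega> T \<xi> = 0}"

section \<open>Helmholtz decomposition\<close>

definition Gspace :: "(real^'n) set \<Rightarrow> real \<Rightarrow> (real^'n \<Rightarrow> real^'n) set" where
  "Gspace \<Omega> q = {v \<in> Lp \<Omega> q. \<exists>\<theta>\<in>W1 \<Omega> q. AE x in lebesgue_on \<Omega>. v x = wgrad \<Omega> \<theta> x}"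

definition Hspace :: "(real^'n) set \<Rightarrow> real \<Rightarrow> (real^'n \<Rightarrow> real^'n) set" where
  "Hspace \<Omega> q = {v \<in> Lp \<Omega> q. has_weak_div \<Omega> v (\<lambda>x. 0) \<and>
                   (\<forall>\<xi>\<in>W1 \<Omega> (conj_exp q). normal_trace_vec \<Omega> v \<xi> = 0)}"

definition helmholtz_decomposition :: "(real^'n) set \<Rightarrow> real \<Rightarrow> bool" where
  "helmholtz_decomposition \<Omega> q \<longleftrightarrow>
     (\<forall>v\<in>Lp \<Omega> q. \<exists>g\<in>Gspace \<Omega> q. \<exists>h\<in>Hspace \<Omega> q. AE x in lebesgue_on \<Omega>. v x = g x + h x) \<and>
     (\<forall>v \<in> Gspace \<Omega> q \<inter> Hspace \<Omega> q. AE x in lebesgue_on \<Omega>. v x = 0)"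

section \<open>State, adjoint state and shape derivative\<close>

definition is_state :: "(real^'n) set \<Rightarrow> (real^'n \<Rightarrow> real) \<Rightarrow> (real^'n \<Rightarrow> real) \<Rightarrow> bool" where
  "is_state \<Omega> f u \<longleftrightarrow>
     u \<in> H10 \<Omega> \<and> (\<forall>v\<in>H10 \<Omega>. pair \<Omega> (wgrad \<Omega> u) (wgrad \<Omega> v) = pair \<Omega> f v)"

definition is_adjoint_state ::
  "(real^'n) set \<Rightarrow> (real \<Rightarrow> real) \<Rightarrow> (real^'n \<Rightarrow> real) \<Rightarrow> (real^'n \<Rightarrow> real) \<Rightarrow> bool" where
  "is_adjoint_state \<Omega> j u y \<longleftrightarrow>
     y \<in> H10 \<Omega> \<and>
     (\<forall>z\<in>H10 \<Omega>. pair \<Omega> (wgrad \<Omega> y) (wgrad \<Omega> z) = - pair \<Omega> (\<lambda>x. deriv j (u x)) z)"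

definition outer_product :: "real^'n \<Rightarrow> real^'n \<Rightarrow> real^'n^'n" where
  "outer_product a b = (\<chi> i k. a $ i * b $ k)"

definition shape_tensor ::
  "(real^'n) set \<Rightarrow> (real^'n \<Rightarrow> real) \<Rightarrow> (real^'n \<Rightarrow> real) \<Rightarrow> real^'n \<Rightarrow> real^'n^'n" where
  "shape_tensor \<Omega> u y x =
     (wgrad \<Omega> u x \<bullet> wgrad \<Omega> y x) *\<^sub>R mat 1
       - outer_product (wgrad \<Omega> y x) (wgrad \<Omega> u x) - outer_product (wgrad \<Omega> u x) (wgrad \<Omega> y x)"

definition shape_derivative ::
  "(real^'n) set \<Rightarrow> (real^'n \<Rightarrow> real) \<Rightarrow> (real \<Rightarrow> real) \<Rightarrow> (real^'n \<Rightarrow> real) \<Rightarrow> (real^'n \<Rightarrow> real)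
     \<Rightarrow> (real^'n \<Rightarrow> real^'n) \<Rightarrow> real" where
  "shape_derivative \<Omega> f j u y \<xi> =
     pair \<Omega> (shape_tensor \<Omega> u y) (wgrad_vec \<Omega> \<xi>)
       + pair \<Omega> (\<lambda>x. f x *\<^sub>R wgrad \<Omega> y x) \<xi>
       + pair \<Omega> (\<lambda>x. j (u x)) (wdiv \<Omega> \<xi>)"

text \<open>Extended reals, so that the infimum over an empty set would be infinite.\<close>

definition eta_p ::
  "(real^'n) set \<Rightarrow> (real^'n \<Rightarrow> real) \<Rightarrow> (real \<Rightarrow> real) \<Rightarrow> (real^'n \<Rightarrow> real) \<Rightarrow> (real^'n \<Rightarrow> real)
     \<Rightarrow> real \<Rightarrow> ereal" where
  "eta_p \<Omega> f j u y p =
     (INF T \<in> {T \<in> Sigma_p0 \<Omega> p. \<forall>\<xi>\<in>W1_vec \<Omega> (conj_exp p).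
                 pair \<Omega> (wdiv_mat \<Omega> T) \<xi> =
                   pair \<Omega> (\<lambda>x. f x *\<^sub>R wgrad \<Omega> y x) \<xi> + pair \<Omega> (\<lambda>x. j (u x)) (wdiv \<Omega> \<xi>)}.
        ereal (Lnorm \<Omega> p (\<lambda>x. T x - shape_tensor \<Omega> u y x)))"

end

theory Submission
  imports Defs "HOL-Computational_Algebra.Polynomial"
begin

text \<open>
  Let \<open>R = S - K\<close> and let \<open>W = |R|\<^sup>p\<^sup>-\<^sup>2 R\<close>, a field in \<open>L\<^sup>q\<close>. Testing the first equation of the
  mixed system with matrix fields that have a single entry, taken from the smooth functions with
  compact support, says precisely that \<open>W\<close> is the weak gradient of \<open>\<theta>\<close>. For every field \<open>T\<close>
  admissible in the definition of \<open>\<eta>\<^sub>p\<close>, the vanishing normal trace turns the shape derivative at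
  \<open>\<xi>\<close> into the pairing of \<open>K - T\<close> with the gradient of \<open>\<xi>\<close>, so Hoelder's inequality bounds every
  quotient by \<open>\<parallel>T - K\<parallel>\<^sub>p\<close>. Since \<open>S\<close> is admissible and Hoelder's inequality is an equality for
  \<open>R\<close> and \<open>W\<close>, the bound \<open>\<parallel>R\<parallel>\<^sub>p\<close> is attained at \<open>\<xi> = - \<theta>\<close>.

  Weak derivatives are only fixed by a choice, so all of this rests on their uniqueness almost
  everywhere, that is, on the fundamental lemma of the calculus of variations.
\<close>

section \<open>Smooth functions with compact support\<close>

text \<open>The flat function exp(-1/t), extended by 0 to t \<le> 0. The polynomial factor in 1/t
  makes the family closed under differentiation, so that smoothness becomes one induction.\<close>

definition exp_flat :: "real poly \<Rightarrow> real \<Rightarrow> real" where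
  "exp_flat P t = (if 0 < t then poly P (inverse t) * exp (- inverse t) else 0)"

lemma tendsto_poly_exp_neg_at_top:
  "((\<lambda>s::real. poly P s * exp (- s)) \<longlongrightarrow> 0) at_top"
proof -
  have "((\<lambda>s::real. \<Sum>i\<le>degree P. coeff P i * (s ^ i / exp s)) \<longlongrightarrow> (\<Sum>i\<le>degree P. coeff P i * 0)) at_top"
    by (intro tendsto_intros tendsto_power_div_exp_0)
  moreover have "(\<lambda>s::real. \<Sum>i\<le>degree P. coeff P i * (s ^ i / exp s)) = (\<lambda>s. poly P s * exp (- s))"
    by (simp add: poly_altdef exp_minus divide_inverse sum_distrib_right mult.assoc)
  ultimately show ?thesis by simp
qed

text \<open>With s = 1/t one has ds/dt = -s^2, so P(s) exp(-s) has derivative s^2 (P - P')(s)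
  exp(-s), and \<open>[:0, 0, 1:]\<close> is the factor s^2. At 0 both one-sided difference
  quotients tend to 0.\<close>

lemma has_real_derivative_exp_flat:
  "(exp_flat P has_real_derivative exp_flat ([:0, 0, 1:] * (P - pderiv P)) t) (at t)"
proof -
  consider "t > 0" | "t < 0" | "t = 0" by linarith
  then show ?thesis
  proof cases
    case 1
    have "((\<lambda>t. poly P (inverse t) * exp (- inverse t)) has_real_derivative
        exp_flat ([:0, 0, 1:] * (P - pderiv P)) t) (at t)"
      unfolding exp_flat_def using 1
      by (auto intro!: derivative_eq_intros simp: algebra_simps power2_eq_square)
    then show ?thesis
      by (rule DERIV_cong_ev[THEN iffD1, rotated 3])
         (use 1 in \<open>auto simp: exp_flat_def eventually_nhds intro!: exI[of _ "{0<..}"]\<close>)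
  next
    case 2
    have "((\<lambda>t. 0) has_real_derivative exp_flat ([:0, 0, 1:] * (P - pderiv P)) t) (at t)"
      using 2 by (simp add: exp_flat_def)
    then show ?thesis
      by (rule DERIV_cong_ev[THEN iffD1, rotated 3])
         (use 2 in \<open>auto simp: exp_flat_def eventually_nhds intro!: exI[of _ "{..<0}"]\<close>)
  next
    case 3
    have "((\<lambda>h. exp_flat P h / h) \<longlongrightarrow> 0) (at_right 0)"
    proof -
      \<comment> \<open>Dividing by h multiplies by 1/h, which \<open>pCons 0 P\<close> absorbs;
        exponential decay at infinity beats this polynomial too.\<close>
      have "((\<lambda>h. poly (pCons 0 P) (inverse h) * exp (- inverse h)) \<longlongrightarrow> 0) (at_right 0)"
        by (rule filterlim_compose[OF tendsto_poly_exp_neg_at_top filterlim_inverse_at_top_right])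
      then show ?thesis
        by (rule Lim_transform_eventually)
           (auto simp: exp_flat_def eventually_at_right_less field_simps intro!: eventually_at_rightI[of 0 1])
    qed
    moreover have "((\<lambda>h. exp_flat P h / h) \<longlongrightarrow> 0) (at_left 0)"
      by (rule tendsto_eventually) (auto simp: exp_flat_def intro!: eventually_at_leftI[of "-1"])
    ultimately show ?thesis
      using 3 by (simp add: DERIV_def exp_flat_def filterlim_split_at)
  qed
qed

section \<open>Calculus of classical gradients and the classes \<open>Ck\<close>\<close>

lemma classical_grad_nth:
  assumes "(\<phi> has_derivative \<phi>') (at x)"
  shows "classical_grad \<phi> x $ i = \<phi>' (axis i 1)"
  using frechet_derivative_at[OF assms] by (simp add: classical_grad_def)

lemma Ck_Suc_imp: "Ck (Suc k) \<phi> \<Longrightarrow> Ck k \<phi>"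
proof (induction k arbitrary: \<phi>)
  case 0
  then show ?case
    by (auto intro!: continuous_at_imp_continuous_on differentiable_imp_continuous_within)
qed auto

lemma classical_grad_add:
  assumes "\<phi> differentiable (at x)" "\<psi> differentiable (at x)"
  shows "classical_grad (\<lambda>x. \<phi> x + \<psi> x) x = classical_grad \<phi> x + classical_grad \<psi> x"
proof -
  have "classical_grad (\<lambda>x. \<phi> x + \<psi> x) x $ i = (classical_grad \<phi> x + classical_grad \<psi> x) $ i" for i
    by (subst classical_grad_nth[OF has_derivative_add[OF assms[unfolded frechet_derivative_works]]])
       (simp add: classical_grad_def)
  then show ?thesis by (simp add: vec_eq_iff)
qed

lemma classical_grad_mult:
  assumes "\<phi> differentiable (at x)" "\<psi> differentiable (at x)"
  shows "classical_grad (\<lambda>x. \<phi> x * \<psi> x) x = \<phi> x *\<^sub>R classical_grad \<psi> x + \<psi> x *\<^sub>R classical_grad \<phi> x"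
proof -
  have "classical_grad (\<lambda>x. \<phi> x * \<psi> x) x $ i
      = (\<phi> x *\<^sub>R classical_grad \<psi> x + \<psi> x *\<^sub>R classical_grad \<phi> x) $ i" for i
    by (subst classical_grad_nth[OF has_derivative_mult[OF assms[unfolded frechet_derivative_works]]])
       (simp add: classical_grad_def)
  then show ?thesis by (simp add: vec_eq_iff)
qed

lemma Ck_add: "Ck k \<phi> \<Longrightarrow> Ck k \<psi> \<Longrightarrow> Ck k (\<lambda>x. \<phi> x + \<psi> x)"
  by (induction k arbitrary: \<phi> \<psi>)
     (auto intro: continuous_intros simp: classical_grad_add)

lemma Ck_mult: "Ck k \<phi> \<Longrightarrow> Ck k \<psi> \<Longrightarrow> Ck k (\<lambda>x. \<phi> x * \<psi> x)"
proof (induction k arbitrary: \<phi> \<psi>)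
  case (Suc k)
  \<comment> \<open>The product rule leaves one factor undifferentiated in each summand, so both
    functions are needed at the lower order as well.\<close>
  note smaller = Ck_Suc_imp[OF Suc.prems(1)] Ck_Suc_imp[OF Suc.prems(2)]
  show ?case
    using Suc.prems smaller by (auto simp: classical_grad_mult intro!: Ck_add Suc.IH)
qed (auto intro: continuous_intros)

lemma classical_grad_const [simp]: "classical_grad (\<lambda>x. c) = (\<lambda>x. 0)"
  by (auto simp: classical_grad_def vec_eq_iff)

lemma Ck_const: "Ck k (\<lambda>x. c)"
  by (induction k arbitrary: c) auto

lemma classical_grad_coord: "classical_grad (\<lambda>x. x $ i) x = axis i 1"
proof -
  have "((\<lambda>x. x $ i) has_derivative (\<lambda>x. x $ i)) (at x)"
    by (rule bounded_linear_imp_has_derivative[OF bounded_linear_vec_nth])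
  from classical_grad_nth[OF this] show ?thesis
    by (auto simp: vec_eq_iff axis_def)
qed

lemma Ck_coord: "Ck k (\<lambda>x. x $ i)"
proof (cases k)
  case (Suc l)
  then show ?thesis
    by (auto simp: classical_grad_coord Ck_const bounded_linear_imp_differentiable bounded_linear_vec_nth)
qed (auto intro!: continuous_intros)

lemma Ck_power: "Ck k \<phi> \<Longrightarrow> Ck k (\<lambda>x. \<phi> x ^ m)"
  by (induction m) (auto intro: Ck_mult Ck_const)

lemma Ck_prod: "finite I \<Longrightarrow> (\<And>i. i \<in> I \<Longrightarrow> Ck k (\<phi> i)) \<Longrightarrow> Ck k (\<lambda>x. \<Prod>i\<in>I. \<phi> i x)"
  by (induction I rule: finite_induct) (auto intro: Ck_mult Ck_const)

text \<open>The induction generalises over P, since each derivative changes the polynomial. The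
  slopes s = 1 and s = -1 later give the lower and the upper faces of a box.\<close>

lemma Ck_exp_flat: "Ck k (\<lambda>x::real^'n. exp_flat P (s * x $ i + c))"
proof (induction k arbitrary: P)
  case 0
  have "isCont (exp_flat P) t" for t
    using has_real_derivative_exp_flat by (rule DERIV_isCont)
  then have "continuous_on UNIV (exp_flat P)" by (simp add: continuous_at_imp_continuous_on)
  then have "continuous_on UNIV (\<lambda>x::real^'n. exp_flat P (s * x $ i + c))"
    by (rule continuous_on_compose2) (auto intro!: continuous_intros)
  then show ?case by simp
next
  case (Suc k)
  have D: "((\<lambda>x. exp_flat P (s * x $ i + c)) has_derivative
      (\<lambda>h. exp_flat ([:0, 0, 1:] * (P - pderiv P)) (s * x $ i + c) * (s * h $ i))) (at x)" for x :: "real^'n"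
    by (rule has_derivative_compose[of "\<lambda>x. s * x $ i + c" _ _ _ "exp_flat P",
          OF _ has_real_derivative_exp_flat[unfolded has_field_derivative_def]])
       (auto intro!: derivative_eq_intros bounded_linear_imp_has_derivative[OF bounded_linear_vec_nth])
  show ?case
    unfolding Ck.simps classical_grad_nth[OF D]
    using D by (auto simp: differentiable_def simp del: mult_pCons_left intro!: Ck_mult Ck_const Suc.IH)
qed

text \<open>A bump function that is positive exactly on the open box: each coordinate contributes
  one flat factor for its lower face and one for its upper face.\<close>

definition smooth_box :: "real^'n \<Rightarrow> real^'n \<Rightarrow> real^'n \<Rightarrow> real" where
  "smooth_box a b x = (\<Prod>i\<in>UNIV. exp_flat 1 (x $ i - a $ i) * exp_flat 1 (b $ i - x $ i))"

lemma Ck_smooth_box: "Ck k (smooth_box a b)"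
proof -
  have "Ck k (\<lambda>x. exp_flat 1 (x $ i - a $ i) * exp_flat 1 (b $ i - x $ i))" for i
    using Ck_mult[OF Ck_exp_flat[of k 1 1 i "- (a $ i)"] Ck_exp_flat[of k 1 "-1" i "b $ i"]]
    by (simp add: algebra_simps)
  then have "Ck k (\<lambda>x. smooth_box a b x)"
    unfolding smooth_box_def by (intro Ck_prod) auto
  then show ?thesis by simp
qed

lemma exp_flat_1_bounds: "0 \<le> exp_flat 1 t" "exp_flat 1 t < 1" "0 < t \<Longrightarrow> 0 < exp_flat 1 t" "t \<le> 0 \<Longrightarrow> exp_flat 1 t = 0"
  by (auto simp: exp_flat_def)

lemma smooth_box_pos: "x \<in> box a b \<Longrightarrow> 0 < smooth_box a b x"
  unfolding smooth_box_def by (intro prod_pos) (auto simp: mem_box_cart exp_flat_1_bounds)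

lemma smooth_box_zero: "x \<notin> box a b \<Longrightarrow> smooth_box a b x = 0"
  unfolding smooth_box_def
  by (auto simp: mem_box_cart not_less intro!: exp_flat_1_bounds(4))

lemma smooth_box_bounds: "0 \<le> smooth_box a b x" "smooth_box a b x \<le> 1"
  unfolding smooth_box_def
  by (auto intro!: prod_nonneg prod_le_1 mult_nonneg_nonneg mult_le_one simp: exp_flat_1_bounds less_imp_le)

section \<open>Test functions and their products with locally integrable functions\<close>

lemma test_functionsD:
  assumes "\<phi> \<in> test_functions \<Omega>"
  shows "Ck k \<phi>" "continuous_on UNIV \<phi>" "\<phi> differentiable (at x)"
    "continuous_on UNIV (\<lambda>x. classical_grad \<phi> x $ i)"
proof -
  have C: "Ck k \<phi>" for k using assms by (simp add: test_functions_def)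
  show "Ck k \<phi>" by (rule C)
  show "continuous_on UNIV \<phi>" "\<phi> differentiable (at x)"
    "continuous_on UNIV (\<lambda>x. classical_grad \<phi> x $ i)"
    using C[of 0] C[of 1] by simp_all
qed

lemma classical_grad_eq_0_outside:
  assumes "closed C" "\<And>x. x \<notin> C \<Longrightarrow> \<phi> x = 0" "x \<notin> C"
  shows "classical_grad \<phi> x = 0"
proof -
  have "(\<phi> has_derivative (\<lambda>h. 0)) (at x)"
    by (rule has_derivative_transform_within_open[where f = "\<lambda>x. 0" and s = "- C"])
       (use assms in auto)
  from classical_grad_nth[OF this] show ?thesis by (simp add: vec_eq_iff)
qed

lemma test_function_support:
  assumes "\<phi> \<in> test_functions \<Omega>"
  obtains C where "compact C" "C \<subseteq> \<Omega>" "\<And>x. x \<notin> C \<Longrightarrow> \<phi> x = 0"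
    "\<And>x. x \<notin> C \<Longrightarrow> classical_grad \<phi> x = 0"
proof
  let ?C = "closure {x. \<phi> x \<noteq> 0}"
  show "compact ?C" "?C \<subseteq> \<Omega>" using assms by (auto simp: test_functions_def)
  show out: "\<phi> x = 0" if "x \<notin> ?C" for x
    using that closure_subset[of "{x. \<phi> x \<noteq> 0}"] by (auto simp: subset_iff)
  show "classical_grad \<phi> x = 0" if "x \<notin> ?C" for x
    by (rule classical_grad_eq_0_outside[OF closed_closure _ that]) (rule out)
qed

lemma test_functionsI:
  assumes "\<And>k. Ck k \<phi>" "compact C" "C \<subseteq> \<Omega>" "\<And>x. x \<notin> C \<Longrightarrow> \<phi> x = 0"
  shows "\<phi> \<in> test_functions \<Omega>"
proof -
  have sub: "closure {x. \<phi> x \<noteq> 0} \<subseteq> C"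
    using assms(2,4) by (intro closure_minimal) (auto simp: compact_imp_closed)
  then have "compact (closure {x. \<phi> x \<noteq> 0})"
    using assms(2) bounded_subset by (auto simp: compact_eq_bounded_closed)
  with sub assms(1,3) show ?thesis by (auto simp: test_functions_def)
qed

lemma continuous_compact_support_bounded:
  fixes \<phi> :: "'a::topological_space \<Rightarrow> real"
  assumes "continuous_on UNIV \<phi>" "compact C" "\<And>x. x \<notin> C \<Longrightarrow> \<phi> x = 0"
  obtains B where "0 < B" "\<And>x. \<bar>\<phi> x\<bar> \<le> B"
proof -
  have "bounded (\<phi> ` C)"
    using assms by (intro compact_imp_bounded compact_continuous_image continuous_on_subset[OF assms(1)]) auto
  then obtain B where "0 < B" "\<And>x. x \<in> C \<Longrightarrow> \<bar>\<phi> x\<bar> \<le> B"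
    by (auto simp: bounded_pos)
  then show thesis
    using that[of B] assms(3) by force
qed

text \<open>A continuous factor supported in a compact subset of \<Omega> reduces local
  integrability to integrability on that compact set. The integrals over \<Omega> and over the whole
  space then agree, which makes translations and boxes of the whole space available.\<close>

lemma loc_integrable_mult_continuous:
  fixes g :: "real^'n \<Rightarrow> 'b::euclidean_space"
  assumes g: "loc_integrable \<Omega> g" and \<Omega>: "\<Omega> \<in> sets lebesgue"
    and \<phi>: "continuous_on UNIV \<phi>" "compact C" "C \<subseteq> \<Omega>" "\<And>x. x \<notin> C \<Longrightarrow> \<phi> x = 0"
  shows "integrable lebesgue (\<lambda>x. \<phi> x *\<^sub>R g x)"
    and "integrable (lebesgue_on \<Omega>) (\<lambda>x. \<phi> x *\<^sub>R g x)"
    and "(\<integral>x. \<phi> x *\<^sub>R g x \<partial>lebesgue_on \<Omega>) = (\<integral>x. \<phi> x *\<^sub>R g x \<partial>lebesgue)"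
proof -
  have gC: "integrable lebesgue (\<lambda>x. indicator C x *\<^sub>R g x)"
    using g \<phi> by (auto simp: loc_integrable_def set_integrable_def)
  have meas: "\<phi> \<in> borel_measurable lebesgue"
    using \<phi>(1) by (intro measurable_completion) (simp add: borel_measurable_continuous_onI)
  obtain B where B: "0 < B" "\<And>x. \<bar>\<phi> x\<bar> \<le> B"
    using continuous_compact_support_bounded[OF \<phi>(1,2,4)] by metis
  \<comment> \<open>The inserted indicator changes nothing because \<phi> vanishes off C, but it
    replaces g by an integrable function.\<close>
  have "integrable lebesgue (\<lambda>x. \<phi> x *\<^sub>R (indicator C x *\<^sub>R g x))"
  proof (rule Bochner_Integration.integrable_bound)
    show "integrable lebesgue (\<lambda>x. B * norm (indicator C x *\<^sub>R g x))"
      using gC by (intro integrable_mult_right integrable_norm)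
    show "(\<lambda>x. \<phi> x *\<^sub>R (indicator C x *\<^sub>R g x)) \<in> borel_measurable lebesgue"
      using meas borel_measurable_integrable[OF gC] by (rule borel_measurable_scaleR)
    show "AE x in lebesgue. norm (\<phi> x *\<^sub>R (indicator C x *\<^sub>R g x)) \<le> norm (B * norm (indicator C x *\<^sub>R g x))"
    proof (rule AE_I2)
      fix x
      have "\<bar>\<phi> x\<bar> * norm (indicator C x *\<^sub>R g x) \<le> B * norm (indicator C x *\<^sub>R g x)"
        by (rule mult_right_mono[OF B(2)]) simp
      then show "norm (\<phi> x *\<^sub>R (indicator C x *\<^sub>R g x)) \<le> norm (B * norm (indicator C x *\<^sub>R g x))"
        using B by (simp add: abs_mult)
    qed
  qed
  moreover have "\<phi> x *\<^sub>R (indicator C x *\<^sub>R g x) = \<phi> x *\<^sub>R g x" for x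
    using \<phi>(4)[of x] by (cases "x \<in> C") auto
  ultimately show 1: "integrable lebesgue (\<lambda>x. \<phi> x *\<^sub>R g x)" by (simp only:)
  have eq: "(\<lambda>x. indicator \<Omega> x *\<^sub>R \<phi> x *\<^sub>R g x) = (\<lambda>x. \<phi> x *\<^sub>R g x)"
  proof
    show "indicator \<Omega> x *\<^sub>R \<phi> x *\<^sub>R g x = \<phi> x *\<^sub>R g x" for x
      using \<phi>(3) \<phi>(4)[of x] by (cases "x \<in> \<Omega>") auto
  qed
  show "integrable (lebesgue_on \<Omega>) (\<lambda>x. \<phi> x *\<^sub>R g x)"
    using 1 \<Omega> by (simp add: integrable_restrict_space eq del: scaleR_scaleR)
  show "(\<integral>x. \<phi> x *\<^sub>R g x \<partial>lebesgue_on \<Omega>) = (\<integral>x. \<phi> x *\<^sub>R g x \<partial>lebesgue)"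
    using \<Omega> by (simp add: integral_restrict_space eq del: scaleR_scaleR)
qed

lemma loc_integrable_mult_test:
  fixes g :: "real^'n \<Rightarrow> 'b::euclidean_space"
  assumes "loc_integrable \<Omega> g" "\<Omega> \<in> sets lebesgue" "\<phi> \<in> test_functions \<Omega>"
  shows "integrable lebesgue (\<lambda>x. \<phi> x *\<^sub>R g x)"
    and "integrable (lebesgue_on \<Omega>) (\<lambda>x. \<phi> x *\<^sub>R g x)"
    and "(\<integral>x. \<phi> x *\<^sub>R g x \<partial>lebesgue_on \<Omega>) = (\<integral>x. \<phi> x *\<^sub>R g x \<partial>lebesgue)"
    and "integrable (lebesgue_on \<Omega>) (\<lambda>x. (classical_grad \<phi> x $ i) *\<^sub>R g x)"
proof -
  obtain C where C: "compact C" "C \<subseteq> \<Omega>" "\<And>x. x \<notin> C \<Longrightarrow> \<phi> x = 0"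
    "\<And>x. x \<notin> C \<Longrightarrow> classical_grad \<phi> x = 0"
    using test_function_support[OF assms(3)] by metis
  show "integrable lebesgue (\<lambda>x. \<phi> x *\<^sub>R g x)"
    and "integrable (lebesgue_on \<Omega>) (\<lambda>x. \<phi> x *\<^sub>R g x)"
    and "(\<integral>x. \<phi> x *\<^sub>R g x \<partial>lebesgue_on \<Omega>) = (\<integral>x. \<phi> x *\<^sub>R g x \<partial>lebesgue)"
    by (rule loc_integrable_mult_continuous[OF assms(1,2) test_functionsD(2)[OF assms(3)] C(1-3)]; simp)+
  show "integrable (lebesgue_on \<Omega>) (\<lambda>x. (classical_grad \<phi> x $ i) *\<^sub>R g x)"
    by (rule loc_integrable_mult_continuous[OF assms(1,2) test_functionsD(4)[OF assms(3)] C(1,2)])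
       (simp add: C(4))
qed

section \<open>The fundamental lemma of the calculus of variations\<close>

text \<open>The closed box is asked to lie in \<Omega>, not only the open one: it carries the
  supports of the approximating test functions and bounds the products by an integrable
  function.\<close>

lemma integral_box_eq_0:
  fixes g :: "real^'n \<Rightarrow> real"
  assumes g: "loc_integrable \<Omega> g" and \<Omega>: "\<Omega> \<in> sets lebesgue"
    and zero: "\<And>\<phi>. \<phi> \<in> test_functions \<Omega> \<Longrightarrow> (\<integral>x. \<phi> x * g x \<partial>lebesgue_on \<Omega>) = 0"
    and sub: "cbox a b \<subseteq> \<Omega>"
  shows "(\<integral>x. indicator (box a b) x * g x \<partial>lebesgue) = 0"
proof -
  \<comment> \<open>These test functions increase to the indicator function of the box.\<close>
  define \<phi> where "\<phi> n x = 1 - (1 - smooth_box a b x) ^ Suc n" for n x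
  have out: "\<phi> n x = 0" if "x \<notin> box a b" for n x
    using that by (simp add: \<phi>_def smooth_box_zero)
  \<comment> \<open>Subtraction is spelled out through sums and products, for which closure of
    \<open>Ck\<close> is available.\<close>
  have "Ck k (\<lambda>x. 1 + (-1) * (1 + (-1) * smooth_box a b x) ^ Suc n)" for k n
    by (intro Ck_add Ck_mult Ck_const Ck_power Ck_smooth_box)
  then have "Ck k (\<phi> n)" for k n
    unfolding \<phi>_def by simp
  then have test: "\<phi> n \<in> test_functions \<Omega>" for n
    by (rule test_functionsI[OF _ compact_cbox sub]) (use out box_subset_cbox in blast)
  have bounds: "0 \<le> (1 - smooth_box a b x) ^ Suc n" "(1 - smooth_box a b x) ^ Suc n \<le> 1" for n x
    using smooth_box_bounds[of a b x] by (auto intro: zero_le_power power_le_one simp del: power_Suc)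
  have int: "integrable lebesgue (\<lambda>x. indicator (cbox a b) x * g x)"
    using g sub by (auto simp: loc_integrable_def set_integrable_def)
  have "(\<lambda>n. \<integral>x. \<phi> n x * g x \<partial>lebesgue) \<longlonglongrightarrow> (\<integral>x. indicator (box a b) x * g x \<partial>lebesgue)"
  proof (rule integral_dominated_convergence)
    have "(\<lambda>x. indicator (box a b) x * (indicator (cbox a b) x * g x)) \<in> borel_measurable lebesgue"
      by (rule borel_measurable_times[OF borel_measurable_indicator borel_measurable_integrable[OF int]]) auto
    also have "(\<lambda>x. indicator (box a b) x * (indicator (cbox a b) x * g x)) = (\<lambda>x. indicator (box a b) x * g x)"
      using box_subset_cbox[of a b] by (fastforce simp: indicator_def)
    finally show "(\<lambda>x. indicator (box a b) x * g x) \<in> borel_measurable lebesgue" .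
    show "(\<lambda>x. \<phi> n x * g x) \<in> borel_measurable lebesgue" for n
      using loc_integrable_mult_test(1)[OF g \<Omega> test] by auto
    show "integrable lebesgue (\<lambda>x. norm (indicator (cbox a b) x * g x))"
      using int by (rule integrable_norm)
    show "AE x in lebesgue. (\<lambda>n. \<phi> n x * g x) \<longlonglongrightarrow> indicator (box a b) x * g x"
    proof (intro AE_I2 tendsto_intros)
      fix x
      show "(\<lambda>n. \<phi> n x) \<longlonglongrightarrow> indicator (box a b) x"
      proof (cases "x \<in> box a b")
        case True
        \<comment> \<open>Inside the box the bump lies in (0, 1], so the base lies in [0, 1) and its
          powers vanish in the limit.\<close>
        have "(\<lambda>n. (1 - smooth_box a b x) ^ n) \<longlonglongrightarrow> 0"
          using smooth_box_bounds[of a b x] smooth_box_pos[OF True] by (intro LIMSEQ_power_zero) auto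
        then have "(\<lambda>n. 1 - (1 - smooth_box a b x) ^ Suc n) \<longlonglongrightarrow> 1 - 0"
          by (intro tendsto_diff tendsto_const) (rule LIMSEQ_Suc)
        then show ?thesis using True by (simp add: \<phi>_def)
      qed (simp add: out)
    qed
    show "AE x in lebesgue. norm (\<phi> n x * g x) \<le> norm (indicator (cbox a b) x * g x)" for n
    proof (rule AE_I2)
      fix x
      have "\<bar>\<phi> n x\<bar> \<le> indicator (cbox a b) x"
        using bounds[of x n] out[of x n] box_subset_cbox[of a b]
        by (cases "x \<in> box a b") (auto simp: \<phi>_def simp del: power_Suc)
      then show "norm (\<phi> n x * g x) \<le> norm (indicator (cbox a b) x * g x)"
        by (simp add: abs_mult mult_right_mono)
    qed
  qed
  moreover have "(\<integral>x. \<phi> n x * g x \<partial>lebesgue) = 0" for n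
    using loc_integrable_mult_test(3)[OF g \<Omega> test[of n]] zero[OF test[of n]] by simp
  ultimately show ?thesis
    by (simp add: LIMSEQ_const_iff)
qed

lemma Int_box_cart:
  fixes a b c d :: "real^'n"
  shows "box a b \<inter> box c d = box (\<chi> i. max (a $ i) (c $ i)) (\<chi> i. min (b $ i) (d $ i))"
  by (auto simp: mem_box_cart)

text \<open>A countable cover for \<open>lborel\<close> serves its completion too, because the
  measures agree on Borel sets. This is what \<open>density_zero\<close> asks for.\<close>

lemma sigma_finite_lebesgue: "sigma_finite_measure (lebesgue :: 'a::euclidean_space measure)"
proof
  obtain A :: "'a set set" where A: "countable A" "A \<subseteq> sets lborel" "\<Union>A = space lborel"
    "\<And>a. a \<in> A \<Longrightarrow> emeasure lborel a \<noteq> \<infinity>"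
    by (metis lborel.sigma_finite_countable)
  show "\<exists>A::'a set set. countable A \<and> A \<subseteq> sets lebesgue \<and> \<Union>A = space lebesgue \<and>
      (\<forall>a\<in>A. emeasure lebesgue a \<noteq> \<infinity>)"
  proof (intro exI[of _ A] conjI ballI)
    show "A \<subseteq> sets lebesgue" "\<Union>A = space lebesgue" using A(2,3) by auto
    show "emeasure lebesgue a \<noteq> \<infinity>" if "a \<in> A" for a
      using A(2) A(4)[OF that] that by (auto simp: subset_iff)
  qed (rule A(1))
qed

text \<open>Dynkin's argument: boxes are stable under intersection and generate the Borel sets, and
  the sets over which G integrates to 0 are closed under complements and disjoint countable unions.
  Vanishing over every Lebesgue set forces G to vanish almost everywhere.\<close>

lemma AE_eq_0_if_box_integrals_eq_0:
  fixes G :: "real^'n \<Rightarrow> real"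
  assumes G: "integrable lebesgue G"
    and total: "(\<integral>x. G x \<partial>lebesgue) = 0"
    and box: "\<And>a b. (\<integral>x. indicator (box a b) x * G x \<partial>lebesgue) = 0"
  shows "AE x in lebesgue. G x = 0"
proof (rule sigma_finite_measure.density_zero[OF sigma_finite_lebesgue G])
  have si: "set_integrable lebesgue A G" if "A \<in> sets lebesgue" for A
    unfolding set_integrable_def by (rule integrable_mult_indicator[OF that G])
  have borel: "set_lebesgue_integral lebesgue A G = 0" if "A \<in> sets borel" for A
  proof -
    have gen: "sigma_sets UNIV (range (\<lambda>(a, b). box a b :: (real^'n) set)) = sets borel"
      by (simp add: borel_eq_box)
    have A: "A \<in> sigma_sets UNIV (range (\<lambda>(a, b). box a b))" using that gen by simp
    show ?thesis
    proof (rule sigma_sets_induct_disjoint[OF _ _ A, where P = "\<lambda>A. set_lebesgue_integral lebesgue A G = 0"])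
      show "Int_stable (range (\<lambda>(a, b). box a b :: (real^'n) set))"
        by (auto simp: Int_stable_def Int_box_cart)
      show "set_lebesgue_integral lebesgue A G = 0" if "A \<in> range (\<lambda>(a, b). box a b)" for A
        using that box by (auto simp: set_lebesgue_integral_def)
      show "set_lebesgue_integral lebesgue (UNIV - A) G = 0"
        if "A \<in> sigma_sets UNIV (range (\<lambda>(a, b). box a b))" "set_lebesgue_integral lebesgue A G = 0" for A
      proof -
        have A: "A \<in> sets lebesgue" using that gen by auto
        \<comment> \<open>Complements are where the vanishing total integral enters.\<close>
        have "set_lebesgue_integral lebesgue (A \<union> (UNIV - A)) G
            = set_lebesgue_integral lebesgue A G + set_lebesgue_integral lebesgue (UNIV - A) G"
          using A by (intro set_integral_Un si) (auto intro: sets.compl_sets[of _ lebesgue, simplified])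
        moreover have "set_lebesgue_integral lebesgue (A \<union> (UNIV - A)) G = 0"
          using total by (simp add: set_lebesgue_integral_def)
        ultimately show ?thesis using that(2) by simp
      qed
      show "set_lebesgue_integral lebesgue (\<Union>i. A i) G = 0"
        if "disjoint_family A" "range A \<subseteq> sigma_sets UNIV (range (\<lambda>(a, b). box a b))"
          "\<And>i::nat. set_lebesgue_integral lebesgue (A i) G = 0" for A
      proof -
        have A: "A i \<in> sets lebesgue" for i using that(2) gen by auto
        have "set_lebesgue_integral lebesgue (\<Union>i. A i) G = (\<Sum>i. set_lebesgue_integral lebesgue (A i) G)"
          using that(1) A by (intro lebesgue_integral_countable_add si) (auto simp: disjoint_family_on_def)
        then show ?thesis using that(3) by simp
      qed
    qed (auto simp: set_lebesgue_integral_def)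
  qed
  \<comment> \<open>A Lebesgue set differs from a Borel set only inside a Borel null set, so its
    integral is already known.\<close>
  fix A :: "(real^'n) set" assume A: "A \<in> sets lebesgue"
  then obtain B N N' where A': "A = B \<union> N" "N \<subseteq> N'" "N' \<in> null_sets lborel" "B \<in> sets lborel"
    by (rule sets_completionE)
  have B: "B \<in> sets lebesgue" using A'(4) by auto
  have "AE x in lebesgue. x \<notin> N'"
    using A'(3) by (intro AE_not_in null_sets_completionI)
  then have "AE x in lebesgue. indicator A x *\<^sub>R G x = indicator B x *\<^sub>R G x"
    by eventually_elim (use A'(1,2) in \<open>auto simp: indicator_def\<close>)
  then have "set_lebesgue_integral lebesgue A G = set_lebesgue_integral lebesgue B G"
    unfolding set_lebesgue_integral_def using si[OF A] si[OF B]
    by (intro integral_cong_AE) (auto simp: set_integrable_def)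
  with borel[of B] A'(4) show "set_lebesgue_integral lebesgue A G = 0" by simp
qed

text \<open>Local integrability gives integrability only on compact sets, so the argument runs on
  closed boxes inside \<Omega>; countably many of them cover \<Omega>.\<close>

lemma du_Bois_Reymond:
  fixes g :: "real^'n \<Rightarrow> real"
  assumes g: "loc_integrable \<Omega> g" and \<Omega>: "open \<Omega>"
    and zero: "\<And>\<phi>. \<phi> \<in> test_functions \<Omega> \<Longrightarrow> (\<integral>x. \<phi> x * g x \<partial>lebesgue_on \<Omega>) = 0"
  shows "AE x in lebesgue_on \<Omega>. g x = 0"
proof -
  have meas: "\<Omega> \<in> sets lebesgue" using \<Omega> by auto
  have cell: "AE x in lebesgue. x \<in> cbox c d \<longrightarrow> g x = 0" if sub: "cbox c d \<subseteq> \<Omega>" for c d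
  proof -
    let ?G = "\<lambda>x. indicator (box c d) x * g x"
    have "set_integrable lebesgue (cbox c d) g"
      using g sub by (auto simp: loc_integrable_def)
    then have "set_integrable lebesgue (box c d) g"
      by (rule set_integrable_subset) (auto simp: box_subset_cbox)
    then have "integrable lebesgue ?G" by (simp add: set_integrable_def)
    moreover have "(\<integral>x. ?G x \<partial>lebesgue) = 0"
      by (rule integral_box_eq_0[OF g meas zero sub])
    \<comment> \<open>Restricting to a second box yields the integral of g over an intersection of
      boxes, again a box whose closed version lies in \<open>cbox c d\<close>.\<close>
    moreover have "(\<integral>x. indicator (box a b) x * ?G x \<partial>lebesgue) = 0" for a b
    proof (cases "box a b \<inter> box c d = {}")
      case True
      then have "(\<lambda>x. indicator (box a b) x * ?G x) = (\<lambda>x. 0)"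
        by (fastforce simp: indicator_def)
      then show ?thesis by simp
    next
      case False
      let ?m = "(\<chi> i. max (a $ i) (c $ i)) :: real^'n" and ?M = "(\<chi> i. min (b $ i) (d $ i)) :: real^'n"
      have "cbox ?m ?M \<subseteq> \<Omega>"
        using sub by (rule order_trans[rotated]) (auto simp: mem_box_cart)
      from integral_box_eq_0[OF g meas zero this]
      have "(\<integral>x. indicator (box a b \<inter> box c d) x * g x \<partial>lebesgue) = 0"
        by (simp add: Int_box_cart)
      then show ?thesis by (simp add: indicator_inter_arith mult.assoc)
    qed
    ultimately have "AE x in lebesgue. ?G x = 0" by (rule AE_eq_0_if_box_integrals_eq_0)
    \<comment> \<open>The faces form a null set, so the open box can be enlarged to the closed
      one.\<close>
    moreover have "AE x in lebesgue. x \<notin> cbox c d - box c d"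
      using negligible_frontier_interval[of c d] by (intro AE_not_in) (simp add: negligible_iff_null_sets)
    ultimately show ?thesis
      by eventually_elim (auto simp: indicator_def split: if_splits)
  qed
  obtain \<D> where D: "countable \<D>" "\<D> \<subseteq> Pow \<Omega>" "\<And>X. X \<in> \<D> \<Longrightarrow> \<exists>a b. X = cbox a b" "\<Union>\<D> = \<Omega>"
    using open_countable_Union_open_cbox[OF \<Omega>] by metis
  \<comment> \<open>Countability of the cover lets the exceptional null sets be united.\<close>
  have "AE x in lebesgue. \<forall>X\<in>\<D>. x \<in> X \<longrightarrow> g x = 0"
    using D(1)
  proof (rule AE_ball_countable[THEN iffD2, rule_format])
    fix X assume "X \<in> \<D>"
    with D(2,3) cell show "AE x in lebesgue. x \<in> X \<longrightarrow> g x = 0" by (metis Pow_iff subsetD)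
  qed
  then have "AE x in lebesgue. x \<in> \<Omega> \<longrightarrow> g x = 0"
    by eventually_elim (use D(4) in blast)
  then show ?thesis
    using meas by (simp add: AE_restrict_space_iff)
qed

section \<open>Weak derivatives\<close>

text \<open>Difference quotients integrate to \<open>0\<close> by translation invariance, and converge dominatedly.\<close>

lemma integral_classical_grad_eq_0:
  fixes u :: "real^'n \<Rightarrow> real"
  assumes u: "Ck 1 u" and C: "compact C" "\<And>x. x \<notin> C \<Longrightarrow> u x = 0"
  shows "(\<integral>x. classical_grad u x $ i \<partial>lebesgue) = 0"
proof -
  define D where "D x = classical_grad u x $ i" for x
  define e :: "real^'n" where "e = axis i 1"
  define h where "h n = inverse (real (Suc n))" for n
  define f where "f n x = (u (x + h n *\<^sub>R e) - u x) / h n" for n x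
  have h: "0 < h n" "h n \<le> 1" for n by (auto simp: h_def field_simps)
  have cont: "continuous_on UNIV u" "continuous_on UNIV D"
    using u Ck_Suc_imp[of 0 u] by (auto simp: D_def)
  have D0: "D x = 0" if "x \<notin> C" for x
    using classical_grad_eq_0_outside[OF compact_imp_closed[OF C(1)] C(2) that] by (simp add: D_def)
  obtain B where B: "0 < B" "\<And>x. \<bar>D x\<bar> \<le> B"
    using continuous_compact_support_bounded[OF cont(2) C(1) D0] by metis
  obtain R where R: "\<And>x. x \<in> C \<Longrightarrow> norm x \<le> R"
    using compact_imp_bounded[OF C(1)] by (auto simp: bounded_iff)
  have deriv: "((\<lambda>t. u (x + t *\<^sub>R e)) has_real_derivative D (x + t *\<^sub>R e)) (at t)" for x t
  proof -
    have "u differentiable (at (x + t *\<^sub>R e))" using u by simp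
    then obtain u' where u': "(u has_derivative u') (at (x + t *\<^sub>R e))" by (auto simp: differentiable_def)
    have "((\<lambda>t. u (x + t *\<^sub>R e)) has_derivative (\<lambda>s. u' (s *\<^sub>R e))) (at t)"
      by (rule has_derivative_compose[where f = "\<lambda>t. x + t *\<^sub>R e" and g = u and g' = u', OF _ u']) (auto intro!: derivative_eq_intros)
    moreover have "u' (s *\<^sub>R e) = D (x + t *\<^sub>R e) * s" for s
      using classical_grad_nth[OF u', of i] has_derivative_linear[OF u']
      by (simp add: D_def e_def linear_cmul)
    ultimately show ?thesis by (simp add: has_field_derivative_def)
  qed
  \<comment> \<open>The mean value theorem makes each difference quotient a value of D, so the bound
    B for D serves uniformly in n.\<close>
  have mvt: "\<exists>z. f n x = D (x + z *\<^sub>R e)" for n x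
  proof -
    have "\<exists>z>0. z < h n \<and> u (x + h n *\<^sub>R e) - u (x + 0 *\<^sub>R e) = (h n - 0) * D (x + z *\<^sub>R e)"
      using h(1)[of n] deriv by (intro MVT2[of 0 "h n" "\<lambda>t. u (x + t *\<^sub>R e)" "\<lambda>t. D (x + t *\<^sub>R e)"]) auto
    then show ?thesis using h(1)[of n] by (auto simp: f_def)
  qed
  have meas: "u \<in> borel_measurable borel" "D \<in> borel_measurable borel"
    using cont by (auto intro: borel_measurable_continuous_onI)
  have int_u: "integrable lborel u"
  proof -
    have "integrable lborel (\<lambda>x. indicator C x *\<^sub>R u x)"
      using C(1) cont(1) by (intro borel_integrable_compact) (auto intro: continuous_on_subset)
    moreover have "indicator C x *\<^sub>R u x = u x" for x using C(2)[of x] by (cases "x \<in> C") auto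
    ultimately show ?thesis by (simp only:)
  qed
  have shift: "integrable lborel (\<lambda>x. u (x + c))" "(\<integral>x. u (x + c) \<partial>lborel) = (\<integral>x. u x \<partial>lborel)" for c
  proof -
    \<comment> \<open>Translation invariance enters as invariance of \<open>lborel\<close> under its
      image by a translation.\<close>
    have eq: "distr lborel borel ((+) c) = lborel" by (rule lborel_distr_plus)
    have "integrable (distr lborel borel ((+) c)) u" using int_u by (simp add: eq)
    then have "integrable lborel (\<lambda>x. u (c + x))"
      by (subst (asm) integrable_distr_eq) (use meas in auto)
    then show "integrable lborel (\<lambda>x. u (x + c))" by (simp add: add.commute)
    have "integral\<^sup>L (distr lborel borel ((+) c)) u = (\<integral>x. u (c + x) \<partial>lborel)"
      by (rule integral_distr) (use meas in auto)
    then show "(\<integral>x. u (x + c) \<partial>lborel) = (\<integral>x. u x \<partial>lborel)" by (simp add: eq add.commute)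
  qed
  have zero: "(\<integral>x. f n x \<partial>lborel) = 0" for n
    unfolding f_def by (simp add: shift int_u)
  have "(\<lambda>n. \<integral>x. f n x \<partial>lborel) \<longlonglongrightarrow> (\<integral>x. D x \<partial>lborel)"
  proof (rule integral_dominated_convergence)
    show "D \<in> borel_measurable lborel" using meas by simp
    show "f n \<in> borel_measurable lborel" for n
    proof -
      have "(\<lambda>x. u (x + h n *\<^sub>R e)) \<in> borel_measurable lborel"
        using shift(1) by (rule borel_measurable_integrable)
      then show ?thesis unfolding f_def using meas by simp
    qed
    \<comment> \<open>The increments have length at most 1 and C lies in the ball of radius R, so
      every quotient vanishes outside the ball of radius R + 1.\<close>
    show "integrable lborel (\<lambda>x::real^'n. B * indicator (cball 0 (R + 1)) x)"
      by (intro integrable_mult_right integrable_real_indicator) (use emeasure_bounded_finite[of "cball (0::real^'n) (R + 1)"] in auto)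
    show "AE x in lborel. (\<lambda>n. f n x) \<longlonglongrightarrow> D x"
    proof (rule AE_I2)
      fix x
      have "((\<lambda>s. (u (x + s *\<^sub>R e) - u x) / s) \<longlongrightarrow> D x) (at 0)"
        using deriv[of x 0] by (simp add: DERIV_def)
      moreover have "filterlim h (at 0) sequentially"
      proof (rule filterlim_atI)
        show "h \<longlonglongrightarrow> 0" unfolding h_def by (rule LIMSEQ_inverse_real_of_nat)
      qed (use h in \<open>simp add: less_imp_neq[THEN not_sym]\<close>)
      ultimately show "(\<lambda>n. f n x) \<longlonglongrightarrow> D x"
        unfolding f_def by (rule filterlim_compose)
    qed
    show "AE x in lborel. norm (f n x) \<le> B * indicator (cball 0 (R + 1)) x" for n
    proof (rule AE_I2)
      fix x
      show "norm (f n x) \<le> B * indicator (cball 0 (R + 1)) x"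
      proof (cases "x \<in> cball 0 (R + 1)")
        case True
        obtain z where "f n x = D (x + z *\<^sub>R e)" using mvt by blast
        then show ?thesis using True B by simp
      next
        case False
        then have "R + 1 < norm x" by simp
        moreover have "norm x \<le> norm (x + h n *\<^sub>R e) + norm (h n *\<^sub>R e)"
          using norm_triangle_ineq4[of "x + h n *\<^sub>R e" "h n *\<^sub>R e"] by simp
        moreover have "norm (h n *\<^sub>R e) \<le> 1" using h[of n] by (simp add: e_def)
        ultimately have "x \<notin> C" "x + h n *\<^sub>R e \<notin> C" using R by fastforce+
        then show ?thesis using C(2) False by (simp add: f_def)
      qed
    qed
  qed
  then have "(\<integral>x. D x \<partial>lborel) = 0" by (simp add: zero LIMSEQ_const_iff)
  \<comment> \<open>D is Borel measurable, so passing to the completion of \<open>lborel\<close>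
    leaves its integral unchanged.\<close>
  then show ?thesis
    using meas by (simp add: D_def[abs_def] integral_completion)
qed

section \<open>Closure properties of local integrability\<close>

lemma loc_integrable_continuous:
  fixes g :: "real^'n \<Rightarrow> 'b::euclidean_space"
  assumes "continuous_on UNIV g"
  shows "loc_integrable \<Omega> g"
  unfolding loc_integrable_def
proof (intro allI impI)
  fix C :: "(real^'n) set" assume C: "compact C \<and> C \<subseteq> \<Omega>"
  obtain a where a: "C \<subseteq> cbox (- a) a"
    using C bounded_subset_cbox_symmetric compact_imp_bounded by metis
  have "g absolutely_integrable_on cbox (- a) a"
    by (rule absolutely_integrable_continuous) (rule continuous_on_subset[OF assms subset_UNIV])
  then show "g absolutely_integrable_on C"
    by (rule set_integrable_subset) (use a C in \<open>auto intro: lmeasurable_compact fmeasurableD\<close>)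
qed

lemma loc_integrable_nth:
  fixes g :: "real^'n \<Rightarrow> real^'m"
  assumes "loc_integrable \<Omega> g"
  shows "loc_integrable \<Omega> (\<lambda>x. g x $ i)"
  unfolding loc_integrable_def
proof (intro allI impI)
  fix C :: "(real^'n) set" assume C: "compact C \<and> C \<subseteq> \<Omega>"
  then have "integrable lebesgue (\<lambda>x. (indicator C x *\<^sub>R g x) $ i)"
    using assms by (intro integrable_bounded_linear[OF bounded_linear_vec_nth])
      (auto simp: loc_integrable_def set_integrable_def)
  then show "(\<lambda>x. g x $ i) absolutely_integrable_on C" by (simp add: set_integrable_def)
qed

lemma loc_integrable_diff:
  fixes g h :: "real^'n \<Rightarrow> 'b::euclidean_space"
  assumes "loc_integrable \<Omega> g" "loc_integrable \<Omega> h"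
  shows "loc_integrable \<Omega> (\<lambda>x. g x - h x)"
  using assms by (auto simp: loc_integrable_def intro: set_integral_diff(1))

text \<open>Coordinates pass through the two vector-valued integrals because both integrands are
  integrable; scalar results can then be applied entry by entry.\<close>

lemma has_weak_grad_iff:
  assumes \<Omega>: "\<Omega> \<in> sets lebesgue"
  shows "has_weak_grad \<Omega> u g \<longleftrightarrow> loc_integrable \<Omega> u \<and> loc_integrable \<Omega> g \<and>
     (\<forall>\<phi>\<in>test_functions \<Omega>. \<forall>i.
        (\<integral>x. u x * classical_grad \<phi> x $ i \<partial>lebesgue_on \<Omega>) = - (\<integral>x. \<phi> x * g x $ i \<partial>lebesgue_on \<Omega>))"
proof -
  have comps: "(\<integral>x. u x *\<^sub>R classical_grad \<phi> x \<partial>lebesgue_on \<Omega>) $ i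
      = (\<integral>x. u x * classical_grad \<phi> x $ i \<partial>lebesgue_on \<Omega>)"
    "(\<integral>x. \<phi> x *\<^sub>R g x \<partial>lebesgue_on \<Omega>) $ i = (\<integral>x. \<phi> x * g x $ i \<partial>lebesgue_on \<Omega>)"
    if u: "loc_integrable \<Omega> u" and g: "loc_integrable \<Omega> g" and \<phi>: "\<phi> \<in> test_functions \<Omega>" for \<phi> i
  proof -
    \<comment> \<open>Integrability of the vector-valued product is assembled from its coordinates
      through the standard basis.\<close>
    have "integrable (lebesgue_on \<Omega>) (\<lambda>x. \<Sum>j\<in>UNIV. (classical_grad \<phi> x $ j *\<^sub>R u x) *\<^sub>R (axis j 1 :: real^'a))"
      by (intro Bochner_Integration.integrable_sum integrable_scaleR_left loc_integrable_mult_test(4)[OF u \<Omega> \<phi>])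
    moreover have "(\<Sum>j\<in>UNIV. (classical_grad \<phi> x $ j *\<^sub>R u x) *\<^sub>R (axis j 1 :: real^'a)) = u x *\<^sub>R classical_grad \<phi> x" for x
      by (simp add: vec_eq_iff axis_def if_distrib[of "(*) _"] cong: if_cong)
    ultimately have "integrable (lebesgue_on \<Omega>) (\<lambda>x. u x *\<^sub>R classical_grad \<phi> x)" by simp
    from integral_bounded_linear[OF bounded_linear_vec_nth[of i] this]
    show "(\<integral>x. u x *\<^sub>R classical_grad \<phi> x \<partial>lebesgue_on \<Omega>) $ i
      = (\<integral>x. u x * classical_grad \<phi> x $ i \<partial>lebesgue_on \<Omega>)" by simp
    from integral_bounded_linear[OF bounded_linear_vec_nth[of i] loc_integrable_mult_test(2)[OF g \<Omega> \<phi>]]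
    show "(\<integral>x. \<phi> x *\<^sub>R g x \<partial>lebesgue_on \<Omega>) $ i = (\<integral>x. \<phi> x * g x $ i \<partial>lebesgue_on \<Omega>)" by simp
  qed
  show ?thesis
    unfolding has_weak_grad_def by (auto simp: vec_eq_iff comps)
qed

text \<open>The product u \<phi> inherits the compact support of \<phi>, so the integral of its
  partial derivative vanishes; the product rule splits it into the two sides.\<close>

lemma integral_by_parts_test:
  assumes \<Omega>: "\<Omega> \<in> sets lebesgue" and u: "\<And>k. Ck k u" and \<phi>: "\<phi> \<in> test_functions \<Omega>"
  shows "(\<integral>x. u x * classical_grad \<phi> x $ i \<partial>lebesgue_on \<Omega>)
    = - (\<integral>x. \<phi> x * classical_grad u x $ i \<partial>lebesgue_on \<Omega>)"
proof -
  obtain C where C: "compact C" "C \<subseteq> \<Omega>" "\<And>x. x \<notin> C \<Longrightarrow> \<phi> x = 0" "\<And>x. x \<notin> C \<Longrightarrow> classical_grad \<phi> x = 0"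
    using test_function_support[OF \<phi>] by metis
  have diff: "u differentiable (at x)" for x using u[of 1] by simp
  have cont: "continuous_on UNIV u" "continuous_on UNIV (\<lambda>x. classical_grad u x $ i)"
    using u[of 0] u[of 1] by simp_all
  have D0: "x \<notin> C \<Longrightarrow> classical_grad \<phi> x $ i = 0" for x using C(4) by simp
  note locs = loc_integrable_continuous[OF cont(1), of \<Omega>] loc_integrable_continuous[OF cont(2), of \<Omega>]
  note p1 = loc_integrable_mult_continuous[OF locs(1) \<Omega> test_functionsD(4)[OF \<phi>] C(1,2) D0]
  note p2 = loc_integrable_mult_continuous[OF locs(2) \<Omega> test_functionsD(2)[OF \<phi>] C(1-3)]
  have "(\<integral>x. classical_grad (\<lambda>x. u x * \<phi> x) x $ i \<partial>lebesgue) = 0"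
  proof (rule integral_classical_grad_eq_0[OF _ C(1)])
    show "Ck 1 (\<lambda>x. u x * \<phi> x)" by (rule Ck_mult[OF u test_functionsD(1)[OF \<phi>]])
  qed (simp add: C(3))
  also have "(\<lambda>x. classical_grad (\<lambda>x. u x * \<phi> x) x $ i)
      = (\<lambda>x. classical_grad \<phi> x $ i *\<^sub>R u x + \<phi> x *\<^sub>R classical_grad u x $ i)"
    by (intro ext) (simp add: classical_grad_mult[OF diff test_functionsD(3)[OF \<phi>]])
  also have "(\<integral>x. classical_grad \<phi> x $ i *\<^sub>R u x + \<phi> x *\<^sub>R classical_grad u x $ i \<partial>lebesgue)
      = (\<integral>x. classical_grad \<phi> x $ i *\<^sub>R u x \<partial>lebesgue) + (\<integral>x. \<phi> x *\<^sub>R classical_grad u x $ i \<partial>lebesgue)"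
    by (rule Bochner_Integration.integral_add[OF p1(1) p2(1)])
  finally show ?thesis using p1(3) p2(3) by (simp add: mult.commute)
qed

lemma has_weak_grad_smooth:
  assumes \<Omega>: "\<Omega> \<in> sets lebesgue" and u: "\<And>k. Ck k u"
  shows "has_weak_grad \<Omega> u (classical_grad u)"
  unfolding has_weak_grad_iff[OF \<Omega>]
proof (intro conjI ballI allI integral_by_parts_test[OF \<Omega> u])
  show "loc_integrable \<Omega> u" "loc_integrable \<Omega> (classical_grad u)"
    using u[of 0] u[of 1] continuous_on_vec_lambda[of UNIV "\<lambda>i x. classical_grad u x $ i"]
    by (auto intro!: loc_integrable_continuous)
qed

text \<open>Provides the weak divergence of a single row with one nonzero entry, the building block
  of the matrix test fields.\<close>

lemma has_weak_div_smooth_axis: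
  assumes \<Omega>: "\<Omega> \<in> sets lebesgue" and u: "\<And>k. Ck k u"
  shows "has_weak_div \<Omega> (\<lambda>x. u x *\<^sub>R axis i 1) (\<lambda>x. classical_grad u x $ i)"
  unfolding has_weak_div_def
proof (intro conjI ballI)
  show "loc_integrable \<Omega> (\<lambda>x. u x *\<^sub>R axis i 1 :: real^'a)" "loc_integrable \<Omega> (\<lambda>x. classical_grad u x $ i)"
    using u[of 0] u[of 1] by (auto intro!: loc_integrable_continuous continuous_on_scaleR)
  show "(\<integral>x. (u x *\<^sub>R axis i 1) \<bullet> classical_grad \<phi> x \<partial>lebesgue_on \<Omega>)
      = - (\<integral>x. \<phi> x * classical_grad u x $ i \<partial>lebesgue_on \<Omega>)" if "\<phi> \<in> test_functions \<Omega>" for \<phi>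
    using integral_by_parts_test[OF \<Omega> u that, of i] by (simp add: inner_axis')
qed

section \<open>Uniqueness of weak derivatives and the chosen representatives\<close>

lemma du_Bois_Reymond_eq:
  fixes g h :: "real^'n \<Rightarrow> real"
  assumes g: "loc_integrable \<Omega> g" and h: "loc_integrable \<Omega> h" and \<Omega>: "open \<Omega>"
    and eq: "\<And>\<phi>. \<phi> \<in> test_functions \<Omega> \<Longrightarrow>
      (\<integral>x. \<phi> x * g x \<partial>lebesgue_on \<Omega>) = (\<integral>x. \<phi> x * h x \<partial>lebesgue_on \<Omega>)"
  shows "AE x in lebesgue_on \<Omega>. g x = h x"
proof -
  have meas: "\<Omega> \<in> sets lebesgue" using \<Omega> by auto
  have "AE x in lebesgue_on \<Omega>. g x - h x = 0"
  proof (rule du_Bois_Reymond[OF loc_integrable_diff[OF g h] \<Omega>])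
    fix \<phi> assume \<phi>: "\<phi> \<in> test_functions \<Omega>"
    show "(\<integral>x. \<phi> x * (g x - h x) \<partial>lebesgue_on \<Omega>) = 0"
      using loc_integrable_mult_test(2)[OF g meas \<phi>] loc_integrable_mult_test(2)[OF h meas \<phi>] eq[OF \<phi>]
      by (simp add: right_diff_distrib)
  qed
  then show ?thesis by simp
qed

lemma has_weak_grad_unique:
  assumes \<Omega>: "open \<Omega>" and g: "has_weak_grad \<Omega> u g" and h: "has_weak_grad \<Omega> u h"
  shows "AE x in lebesgue_on \<Omega>. g x = h x"
proof -
  have meas: "\<Omega> \<in> sets lebesgue" using \<Omega> by auto
  have "AE x in lebesgue_on \<Omega>. \<forall>i\<in>UNIV. g x $ i = h x $ i"
    using g h unfolding has_weak_grad_iff[OF meas]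
    by (intro AE_finite_allI du_Bois_Reymond_eq[OF _ _ \<Omega>] loc_integrable_nth) auto
  then show ?thesis by (simp add: vec_eq_iff)
qed

lemma has_weak_div_unique:
  assumes "open \<Omega>" "has_weak_div \<Omega> v g" "has_weak_div \<Omega> v h"
  shows "AE x in lebesgue_on \<Omega>. g x = h x"
  using assms unfolding has_weak_div_def by (intro du_Bois_Reymond_eq) auto

lemma has_weak_grad_wgrad:
  assumes "has_weak_grad \<Omega> u g"
  shows "has_weak_grad \<Omega> u (wgrad \<Omega> u)"
  unfolding wgrad_def by (rule someI[where P = "has_weak_grad \<Omega> u", OF assms])

lemma has_weak_div_wdiv:
  assumes "has_weak_div \<Omega> v g"
  shows "has_weak_div \<Omega> v (wdiv \<Omega> v)"
  unfolding wdiv_def by (rule someI[where P = "has_weak_div \<Omega> v", OF assms])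

lemma wgrad_AE_eq:
  assumes "open \<Omega>" "has_weak_grad \<Omega> u g"
  shows "AE x in lebesgue_on \<Omega>. wgrad \<Omega> u x = g x"
  using has_weak_grad_unique[OF assms(1) has_weak_grad_wgrad[OF assms(2)] assms(2)] .

lemma wdiv_AE_eq:
  assumes "open \<Omega>" "has_weak_div \<Omega> v g"
  shows "AE x in lebesgue_on \<Omega>. wdiv \<Omega> v x = g x"
  using has_weak_div_unique[OF assms(1) has_weak_div_wdiv[OF assms(2)] assms(2)] .

section \<open>Lebesgue spaces\<close>

lemma LpD:
  assumes "u \<in> Lp \<Omega> p"
  shows "u \<in> borel_measurable (lebesgue_on \<Omega>)" "integrable (lebesgue_on \<Omega>) (\<lambda>x. norm (u x) powr p)"
  using assms by (auto simp: Lp_def)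

text \<open>Bounding a + b by twice the maximum gives a crude constant, enough for closure of
  \<open>Lp\<close> under sums.\<close>

lemma powr_add_le:
  fixes a b p :: real
  assumes "0 \<le> a" "0 \<le> b" "0 \<le> p"
  shows "(a + b) powr p \<le> 2 powr p * (a powr p + b powr p)"
proof -
  have "(a + b) powr p \<le> (2 * max a b) powr p"
    using assms by (intro powr_mono2) auto
  also have "\<dots> = 2 powr p * max a b powr p"
    using assms by (simp add: powr_mult)
  also have "\<dots> \<le> 2 powr p * (a powr p + b powr p)"
    by (intro mult_left_mono) (auto simp: max_def)
  finally show ?thesis .
qed

lemma Lp_bound:
  assumes "u \<in> borel_measurable (lebesgue_on \<Omega>)" "0 \<le> p"
    and "integrable (lebesgue_on \<Omega>) h" "\<And>x. norm (u x) powr p \<le> h x"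
  shows "u \<in> Lp \<Omega> p"
proof -
  have "integrable (lebesgue_on \<Omega>) (\<lambda>x. norm (u x) powr p)"
    by (rule Bochner_Integration.integrable_bound[OF assms(3)])
       (use assms(1,4) in \<open>auto intro!: AE_I2 order_trans[OF assms(4) abs_ge_self]\<close>)
  then show ?thesis using assms(1) by (simp add: Lp_def)
qed

lemma Lp_add:
  assumes "u \<in> Lp \<Omega> p" "v \<in> Lp \<Omega> p" "0 \<le> p"
  shows "(\<lambda>x. u x + v x) \<in> Lp \<Omega> p"
proof (rule Lp_bound)
  show "(\<lambda>x. u x + v x) \<in> borel_measurable (lebesgue_on \<Omega>)"
    using LpD(1)[OF assms(1)] LpD(1)[OF assms(2)] by simp
  show "integrable (lebesgue_on \<Omega>) (\<lambda>x. 2 powr p * (norm (u x) powr p + norm (v x) powr p))"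
    using LpD(2)[OF assms(1)] LpD(2)[OF assms(2)] by simp
  show "norm (u x + v x) powr p \<le> 2 powr p * (norm (u x) powr p + norm (v x) powr p)" for x
    by (rule order_trans[OF powr_mono2[OF assms(3) _ norm_triangle_ineq] powr_add_le]) (use assms(3) in auto)
qed (rule assms(3))

lemma Lp_bounded_linear:
  fixes u :: "real^'n \<Rightarrow> 'b::euclidean_space" and L :: "'b \<Rightarrow> 'c::euclidean_space"
  assumes u: "u \<in> Lp \<Omega> p" and L: "bounded_linear L" and p: "0 \<le> p"
  shows "(\<lambda>x. L (u x)) \<in> Lp \<Omega> p"
proof -
  obtain K where K: "0 < K" "\<And>z. norm (L z) \<le> norm z * K"
    using bounded_linear.pos_bounded[OF L] by blast
  show ?thesis
  proof (rule Lp_bound)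
    show "(\<lambda>x. L (u x)) \<in> borel_measurable (lebesgue_on \<Omega>)"
      using LpD(1)[OF u] L
      by (intro borel_measurable_continuous_on[of L]) (auto intro: linear_continuous_on)
    show "integrable (lebesgue_on \<Omega>) (\<lambda>x. norm (u x) powr p * K powr p)"
      using LpD(2)[OF u] by simp
    show "norm (L (u x)) powr p \<le> norm (u x) powr p * K powr p" for x
      using powr_mono2[OF p norm_ge_zero K(2)] K(1) by (simp add: powr_mult)
  qed (rule p)
qed

lemma Lp_diff:
  assumes "u \<in> Lp \<Omega> p" "v \<in> Lp \<Omega> p" "0 \<le> p"
  shows "(\<lambda>x. u x - v x) \<in> Lp \<Omega> p"
  using Lp_add[OF assms(1) Lp_bounded_linear[OF assms(2) bounded_linear_minus[OF bounded_linear_ident] assms(3)] assms(3)]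
  by simp

lemma Lp_zero: "(\<lambda>x. 0) \<in> Lp \<Omega> p"
  by (simp add: Lp_def)

lemma Lp_sum:
  assumes "finite I" "\<And>i. i \<in> I \<Longrightarrow> u i \<in> Lp \<Omega> p" "0 \<le> p"
  shows "(\<lambda>x. \<Sum>i\<in>I. u i x) \<in> Lp \<Omega> p"
  using assms by (induction I rule: finite_induct) (auto intro: Lp_add simp: Lp_zero)

lemma bounded_linear_axis: "bounded_linear (axis i :: 'b::euclidean_space \<Rightarrow> 'b^'m)"
  unfolding linear_conv_bounded_linear[symmetric] by (rule linearI) (auto simp: vec_eq_iff axis_def)

lemma Lp_vecI:
  fixes F :: "real^'n \<Rightarrow> 'b::euclidean_space^'m"
  assumes "\<And>i. (\<lambda>x. F x $ i) \<in> Lp \<Omega> p" "0 \<le> p"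
  shows "F \<in> Lp \<Omega> p"
proof -
  \<comment> \<open>The field is rebuilt as a finite sum of its coordinates, each embedded by the
    bounded linear map \<open>axis i\<close>.\<close>
  have "(\<lambda>x. \<Sum>i\<in>UNIV. axis i (F x $ i)) \<in> Lp \<Omega> p"
    by (intro Lp_sum Lp_bounded_linear[OF assms(1) bounded_linear_axis] assms(2)) auto
  moreover have "(\<Sum>i\<in>UNIV. axis i (F x $ i)) = F x" for x
    by (simp add: vec_eq_iff axis_def if_distrib cong: if_cong)
  ultimately show ?thesis by simp
qed

text \<open>Completeness of Lebesgue measure, applied to extensions by zero. It makes measurable the
  representatives picked by choice, which are determined only up to null sets.\<close>

lemma borel_measurable_lebesgue_on_AE:
  fixes f g :: "'a::euclidean_space \<Rightarrow> 'b::euclidean_space"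
  assumes \<Omega>: "\<Omega> \<in> sets lebesgue" and f: "f \<in> borel_measurable (lebesgue_on \<Omega>)"
    and eq: "AE x in lebesgue_on \<Omega>. f x = g x"
  shows "g \<in> borel_measurable (lebesgue_on \<Omega>)"
proof -
  have "AE x in lebesgue. indicator \<Omega> x *\<^sub>R f x = indicator \<Omega> x *\<^sub>R g x"
    using eq \<Omega> by (subst (asm) AE_restrict_space_iff) (auto elim!: eventually_mono simp: indicator_def)
  moreover have "(\<lambda>x. indicator \<Omega> x *\<^sub>R f x) \<in> borel_measurable lebesgue"
    using f \<Omega> by (simp add: borel_measurable_restrict_space_iff)
  ultimately have "(\<lambda>x. indicator \<Omega> x *\<^sub>R g x) \<in> borel_measurable lebesgue"
    by (rule borel_measurable_AE[rotated])
  then show ?thesis using \<Omega> by (simp add: borel_measurable_restrict_space_iff)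
qed

lemma Lp_cong_AE:
  fixes f g :: "real^'n \<Rightarrow> 'b::euclidean_space"
  assumes \<Omega>: "\<Omega> \<in> sets lebesgue" and f: "f \<in> Lp \<Omega> p" and eq: "AE x in lebesgue_on \<Omega>. f x = g x"
  shows "g \<in> Lp \<Omega> p"
proof -
  have g: "g \<in> borel_measurable (lebesgue_on \<Omega>)"
    by (rule borel_measurable_lebesgue_on_AE[OF \<Omega> LpD(1)[OF f] eq])
  have "integrable (lebesgue_on \<Omega>) (\<lambda>x. norm (g x) powr p)"
    by (rule integrable_cong_AE_imp[OF LpD(2)[OF f]]) (use g eq in \<open>auto elim: eventually_mono\<close>)
  with g show ?thesis by (simp add: Lp_def)
qed

lemma finite_measure_lebesgue_on_bounded:
  assumes "\<Omega> \<in> sets lebesgue" "bounded \<Omega>"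
  shows "finite_measure (lebesgue_on \<Omega>)"
  using assms by (intro finite_measure_lebesgue_on bounded_set_imp_lmeasurable)

text \<open>Constants are integrable on a bounded domain, and t \<le> 1 + t^p for t \<ge> 0 and p
  \<ge> 1 then dominates u.\<close>

lemma Lp_loc_integrable:
  fixes u :: "real^'n \<Rightarrow> 'b::euclidean_space"
  assumes \<Omega>: "\<Omega> \<in> sets lebesgue" "bounded \<Omega>" and u: "u \<in> Lp \<Omega> p" and p: "1 \<le> p"
  shows "loc_integrable \<Omega> u"
proof -
  interpret finite_measure "lebesgue_on \<Omega>" by (rule finite_measure_lebesgue_on_bounded[OF \<Omega>])
  have "integrable (lebesgue_on \<Omega>) u"
  proof (rule Bochner_Integration.integrable_bound)
    show "integrable (lebesgue_on \<Omega>) (\<lambda>x. 1 + norm (u x) powr p)"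
      using LpD(2)[OF u] by simp
    show "AE x in lebesgue_on \<Omega>. norm (u x) \<le> norm (1 + norm (u x) powr p)"
    proof (rule AE_I2)
      fix x
      show "norm (u x) \<le> norm (1 + norm (u x) powr p)"
      proof (cases "norm (u x) \<le> 1")
        case False
        then have "norm (u x) powr 1 \<le> norm (u x) powr p" using p by (intro powr_mono) auto
        then show ?thesis using False by simp
      qed (simp add: add_increasing2)
    qed
  qed (rule LpD(1)[OF u])
  then have "set_integrable lebesgue \<Omega> u"
    using \<Omega> by (simp add: integrable_restrict_space set_integrable_def)
  then show ?thesis
    unfolding loc_integrable_def
    by (auto intro: set_integrable_subset lmeasurable_compact fmeasurableD)
qed

section \<open>Conjugate exponents and Hoelder's inequality\<close>

lemma conj_exp_properties:
  assumes "1 < p"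
  shows "1 < conj_exp p" "1 / p + 1 / conj_exp p = 1" "(p - 1) * conj_exp p = p"
  using assms by (auto simp: conj_exp_def field_simps)

text \<open>Young's inequality pointwise gives integrability; after scaling both functions to norm 1
  its integral gives the product bound.\<close>

lemma Holder:
  fixes u v :: "real^'n \<Rightarrow> 'b::euclidean_space"
  assumes u: "u \<in> Lp \<Omega> p" and v: "v \<in> Lp \<Omega> q" and p: "1 < p" and q: "q = conj_exp p"
  shows "integrable (lebesgue_on \<Omega>) (\<lambda>x. u x \<bullet> v x)"
    and "\<bar>pair \<Omega> u v\<bar> \<le> Lnorm \<Omega> p u * Lnorm \<Omega> q v"
proof -
  note [measurable] = LpD(1)[OF u] LpD(1)[OF v]
  have q1: "1 < q" and pq: "1 / p + 1 / q = 1" using conj_exp_properties[OF p] q by auto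
  have young: "\<bar>u x \<bullet> v x\<bar> \<le> norm (u x) powr p / p + norm (v x) powr q / q" for x
    using Cauchy_Schwarz_ineq2[of "u x" "v x"] Youngs_inequality[OF p q1 pq, of "norm (u x)" "norm (v x)"] by simp
  have bint: "integrable (lebesgue_on \<Omega>) (\<lambda>x. c * norm (u x) powr p + d * norm (v x) powr q)" for c d
    using LpD(2)[OF u] LpD(2)[OF v] by simp
  show int: "integrable (lebesgue_on \<Omega>) (\<lambda>x. u x \<bullet> v x)"
    by (rule Bochner_Integration.integrable_bound[OF bint[of "1/p" "1/q"]])
       (use young in \<open>auto intro!: AE_I2 order_trans[OF young abs_ge_self]\<close>)
  define A where "A = (\<integral>x. norm (u x) powr p \<partial>lebesgue_on \<Omega>)"
  define B where "B = (\<integral>x. norm (v x) powr q \<partial>lebesgue_on \<Omega>)"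
  have AB: "0 \<le> A" "0 \<le> B" by (auto simp: A_def B_def)
  show "\<bar>pair \<Omega> u v\<bar> \<le> Lnorm \<Omega> p u * Lnorm \<Omega> q v"
  \<comment> \<open>Scaling is impossible if a norm is 0, but then the product vanishes almost
    everywhere.\<close>
  proof (cases "A = 0 \<or> B = 0")
    case True
    have "AE x in lebesgue_on \<Omega>. u x \<bullet> v x = 0"
    proof (cases "A = 0")
      case True
      then have "AE x in lebesgue_on \<Omega>. norm (u x) powr p = 0"
        unfolding A_def by (subst (asm) integral_nonneg_eq_0_iff_AE[OF LpD(2)[OF u]]) auto
      then show ?thesis by eventually_elim auto
    next
      case False
      then have "AE x in lebesgue_on \<Omega>. norm (v x) powr q = 0"
        using True unfolding B_def by (subst (asm) integral_nonneg_eq_0_iff_AE[OF LpD(2)[OF v]]) auto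
      then show ?thesis by eventually_elim auto
    qed
    then have "pair \<Omega> u v = 0" unfolding pair_def by (rule integral_eq_zero_AE)
    then show ?thesis by (simp add: Lnorm_def)
  next
    case False
    define a where "a = A powr (1 / p)"
    define b where "b = B powr (1 / q)"
    have ab: "0 < a" "0 < b" "a powr p = A" "b powr q = B"
      using False AB p q1 by (auto simp: a_def b_def powr_powr)
    \<comment> \<open>Young's inequality for u/a and v/b, multiplied back by a b; a^p = A and b^q =
      B turn the scaled powers into quotients by A and B.\<close>
    have pt: "\<bar>u x \<bullet> v x\<bar> \<le> a * b * (1 / (p * A) * norm (u x) powr p + 1 / (q * B) * norm (v x) powr q)" for x
    proof -
      have "norm (u x) / a * (norm (v x) / b) \<le> (norm (u x) / a) powr p / p + (norm (v x) / b) powr q / q"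
        using ab by (intro Youngs_inequality[OF p q1 pq]) auto
      also have "\<dots> = 1 / (p * A) * norm (u x) powr p + 1 / (q * B) * norm (v x) powr q"
        using ab by (simp add: powr_divide mult.commute)
      finally have "norm (u x) * norm (v x) \<le> a * b * (1 / (p * A) * norm (u x) powr p + 1 / (q * B) * norm (v x) powr q)"
        using ab by (simp add: pos_divide_le_eq mult.commute)
      then show ?thesis using Cauchy_Schwarz_ineq2[of "u x" "v x"] by linarith
    qed
    have "\<bar>pair \<Omega> u v\<bar> \<le> (\<integral>x. \<bar>u x \<bullet> v x\<bar> \<partial>lebesgue_on \<Omega>)"
      unfolding pair_def by (rule integral_abs_bound)
    also have "\<dots> \<le> (\<integral>x. a * b * (1 / (p * A) * norm (u x) powr p + 1 / (q * B) * norm (v x) powr q) \<partial>lebesgue_on \<Omega>)"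
      using int bint[of "1 / (p * A)" "1 / (q * B)"] pt
      by (intro integral_mono integrable_abs integrable_mult_right) auto
    also have "\<dots> = a * b * (1 / (p * A) * A + 1 / (q * B) * B)"
      using LpD(2)[OF u] LpD(2)[OF v] by (simp add: A_def B_def)
    \<comment> \<open>The bracket is 1/p + 1/q = 1.\<close>
    also have "\<dots> = a * b"
      using False pq p q1 by simp
    finally show ?thesis by (simp add: Lnorm_def a_def b_def A_def B_def)
  qed
qed

section \<open>Norms and pairings up to null sets\<close>

lemma Lnorm_nonneg: "0 \<le> Lnorm \<Omega> p u"
  by (simp add: Lnorm_def)

lemma Lnorm_eq_0_iff:
  assumes "u \<in> Lp \<Omega> p"
  shows "Lnorm \<Omega> p u = 0 \<longleftrightarrow> (AE x in lebesgue_on \<Omega>. u x = 0)"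
  using integral_nonneg_eq_0_iff_AE[OF LpD(2)[OF assms]] by (simp add: Lnorm_def)

lemma Lnorm_cong_AE:
  assumes "u \<in> borel_measurable (lebesgue_on \<Omega>)" "v \<in> borel_measurable (lebesgue_on \<Omega>)"
    "AE x in lebesgue_on \<Omega>. norm (u x) = norm (v x)"
  shows "Lnorm \<Omega> p u = Lnorm \<Omega> p v"
proof -
  have "(\<integral>x. norm (u x) powr p \<partial>lebesgue_on \<Omega>) = (\<integral>x. norm (v x) powr p \<partial>lebesgue_on \<Omega>)"
    by (rule integral_cong_AE) (use assms in \<open>auto elim: eventually_mono\<close>)
  then show ?thesis by (simp add: Lnorm_def)
qed

lemma pair_cong_AE:
  assumes "u \<in> borel_measurable (lebesgue_on \<Omega>)" "v \<in> borel_measurable (lebesgue_on \<Omega>)"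
    "w \<in> borel_measurable (lebesgue_on \<Omega>)" "AE x in lebesgue_on \<Omega>. v x = w x"
  shows "pair \<Omega> u v = pair \<Omega> u w"
  unfolding pair_def
  by (rule integral_cong_AE) (use assms in \<open>auto elim: eventually_mono\<close>)

section \<open>Sobolev functions and the multiplier\<close>

lemma Lp_continuous:
  fixes u :: "real^'n \<Rightarrow> 'b::euclidean_space"
  assumes \<Omega>: "\<Omega> \<in> sets lebesgue" "bounded \<Omega>" and u: "continuous_on UNIV u" and p: "0 \<le> p"
  shows "u \<in> Lp \<Omega> p"
proof -
  interpret finite_measure "lebesgue_on \<Omega>" by (rule finite_measure_lebesgue_on_bounded[OF \<Omega>])
  have "compact (u ` closure \<Omega>)"
    using \<Omega>(2) u by (intro compact_continuous_image) (auto simp: compact_closure intro: continuous_on_subset)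
  then obtain B where B: "\<And>x. x \<in> closure \<Omega> \<Longrightarrow> norm (u x) \<le> B"
    using compact_imp_bounded by (fastforce simp: bounded_iff)
  have meas: "u \<in> borel_measurable (lebesgue_on \<Omega>)"
    using u by (intro measurable_restrict_space1 measurable_completion) (simp add: borel_measurable_continuous_onI)
  moreover have "integrable (lebesgue_on \<Omega>) (\<lambda>x. norm (u x) powr p)"
  proof (rule integrable_const_bound)
    show "AE x in lebesgue_on \<Omega>. norm (norm (u x) powr p) \<le> B powr p"
      using B closure_subset[of \<Omega>] p by (intro AE_I2) (auto intro!: powr_mono2)
  qed (use meas in measurable)
  ultimately show ?thesis by (simp add: Lp_def)
qed

text \<open>Membership in \<open>W1\<close> promises integrability of some weak gradient; uniqueness
  almost everywhere carries it over to the chosen one.\<close>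

lemma W1_wgrad:
  assumes \<Omega>: "open \<Omega>" and u: "u \<in> W1 \<Omega> q"
  shows "has_weak_grad \<Omega> u (wgrad \<Omega> u)" "wgrad \<Omega> u \<in> Lp \<Omega> q"
proof -
  obtain g where g: "g \<in> Lp \<Omega> q" "has_weak_grad \<Omega> u g" using u by (auto simp: W1_def)
  show w: "has_weak_grad \<Omega> u (wgrad \<Omega> u)" by (rule has_weak_grad_wgrad[OF g(2)])
  show "wgrad \<Omega> u \<in> Lp \<Omega> q"
    by (rule Lp_cong_AE[OF _ g(1) has_weak_grad_unique[OF \<Omega> g(2) w]]) (use \<Omega> in auto)
qed

lemma wgrad_vec_Lp:
  assumes "open \<Omega>" "\<xi> \<in> W1_vec \<Omega> q" "0 \<le> q"
  shows "wgrad_vec \<Omega> \<xi> \<in> Lp \<Omega> q"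
proof (rule Lp_vecI)
  fix i
  have "(\<lambda>x. \<xi> x $ i) \<in> W1 \<Omega> q" using assms(2) by (simp add: W1_vec_def)
  from W1_wgrad(2)[OF assms(1) this] show "(\<lambda>x. wgrad_vec \<Omega> \<xi> x $ i) \<in> Lp \<Omega> q"
    by (simp add: wgrad_vec_def)
qed (rule assms(3))

lemma wgrad_vec_AE_eq:
  assumes \<Omega>: "open \<Omega>" and g: "\<And>i. has_weak_grad \<Omega> (\<lambda>x. \<xi> x $ i) (\<lambda>x. G x $ i)"
  shows "AE x in lebesgue_on \<Omega>. wgrad_vec \<Omega> \<xi> x = G x"
proof -
  have "AE x in lebesgue_on \<Omega>. \<forall>i\<in>UNIV. wgrad_vec \<Omega> \<xi> x $ i = G x $ i"
    using wgrad_AE_eq[OF \<Omega> g] by (intro AE_finite_allI) (auto simp: wgrad_vec_def)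
  then show ?thesis by (simp add: vec_eq_iff)
qed

lemma loc_integrable_uminus:
  fixes g :: "real^'n \<Rightarrow> 'b::euclidean_space"
  assumes "loc_integrable \<Omega> g"
  shows "loc_integrable \<Omega> (\<lambda>x. - g x)"
  using loc_integrable_diff[OF loc_integrable_continuous[OF continuous_on_const[of UNIV 0]] assms] by simp

lemma has_weak_grad_uminus:
  assumes "has_weak_grad \<Omega> u g"
  shows "has_weak_grad \<Omega> (\<lambda>x. - u x) (\<lambda>x. - g x)"
  using assms by (auto simp: has_weak_grad_def intro: loc_integrable_uminus)

text \<open>The gradients of \<xi> and -\<xi> are chosen independently, so they are known to be
  opposite only almost everywhere. Used to pass from the multiplier \<theta> to the maximiser
  -\<theta>.\<close>

lemma W1_vec_uminus:
  assumes \<Omega>: "open \<Omega>" and \<xi>: "\<xi> \<in> W1_vec \<Omega> q" and q: "0 \<le> q"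
  shows "(\<lambda>x. - \<xi> x) \<in> W1_vec \<Omega> q"
    and "AE x in lebesgue_on \<Omega>. wgrad_vec \<Omega> (\<lambda>x. - \<xi> x) x = - wgrad_vec \<Omega> \<xi> x"
proof -
  have comp: "(\<lambda>x. \<xi> x $ i) \<in> W1 \<Omega> q" for i using \<xi> by (simp add: W1_vec_def)
  note weak = has_weak_grad_uminus[OF W1_wgrad(1)[OF \<Omega> comp]]
  have neg: "(\<lambda>x. - v x) \<in> Lp \<Omega> q" if "v \<in> Lp \<Omega> q" for v :: "real^'a \<Rightarrow> 'b::euclidean_space"
    using Lp_diff[OF Lp_zero that q] by simp
  have "(\<lambda>x. - (\<xi> x $ i)) \<in> W1 \<Omega> q" for i
    using neg[of "\<lambda>x. \<xi> x $ i"] neg[OF W1_wgrad(2)[OF \<Omega> comp]] comp[of i] weak[of i]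
    by (auto simp: W1_def)
  then show "(\<lambda>x. - \<xi> x) \<in> W1_vec \<Omega> q" by (simp add: W1_vec_def)
  show "AE x in lebesgue_on \<Omega>. wgrad_vec \<Omega> (\<lambda>x. - \<xi> x) x = - wgrad_vec \<Omega> \<xi> x"
    by (rule wgrad_vec_AE_eq[OF \<Omega>]) (use weak in \<open>simp add: wgrad_vec_def\<close>)
qed

lemma not_AE_False_open:
  fixes \<Omega> :: "'a::euclidean_space set"
  assumes "open \<Omega>" "\<Omega> \<noteq> {}"
  shows "\<not> (AE x in lebesgue_on \<Omega>. False)"
proof
  assume "AE x in lebesgue_on \<Omega>. False"
  then have "AE x in lebesgue. x \<notin> \<Omega>" using assms(1) by (simp add: AE_restrict_space_iff)
  then have "\<Omega> \<in> null_sets lebesgue" using assms(1) by (subst AE_iff_null_sets) auto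
  then show False using open_not_negligible[OF assms] by (simp add: negligible_iff_null_sets)
qed

text \<open>A witness that the supremum ranges over a nonempty set: its gradient is the identity
  matrix, and a nonempty open set is not null.\<close>

lemma identity_W1_vec:
  fixes \<Omega> :: "(real^'n) set"
  assumes \<Omega>: "open \<Omega>" "bounded \<Omega>" "\<Omega> \<noteq> {}" and q: "0 \<le> q"
  shows "(\<lambda>x. x) \<in> W1_vec \<Omega> q" "\<not> (AE x in lebesgue_on \<Omega>. wgrad_vec \<Omega> (\<lambda>x. x) x = 0)"
proof -
  have meas: "\<Omega> \<in> sets lebesgue" using \<Omega>(1) by auto
  have weak: "has_weak_grad \<Omega> (\<lambda>x. x $ i) (\<lambda>x. axis i 1)" for i
    using has_weak_grad_smooth[OF meas Ck_coord[of _ i]] by (simp add: classical_grad_coord[abs_def])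
  show "(\<lambda>x. x) \<in> W1_vec \<Omega> q"
    unfolding W1_vec_def W1_def
    using weak by (auto intro!: Lp_continuous[OF meas \<Omega>(2) _ q] bexI[of _ "\<lambda>x. axis _ 1"] continuous_intros)
  have AE: "AE x in lebesgue_on \<Omega>. wgrad_vec \<Omega> (\<lambda>x. x) x = (\<chi> i. axis i 1)"
    by (rule wgrad_vec_AE_eq[OF \<Omega>(1)]) (use weak in simp)
  have ne: "(\<chi> i. axis i 1) \<noteq> (0 :: real^'n^'n)" by (auto simp: vec_eq_iff axis_def)
  show "\<not> (AE x in lebesgue_on \<Omega>. wgrad_vec \<Omega> (\<lambda>x. x) x = 0)"
  proof
    assume "AE x in lebesgue_on \<Omega>. wgrad_vec \<Omega> (\<lambda>x. x) x = 0"
    with AE have "AE x in lebesgue_on \<Omega>. False" by eventually_elim (use ne in simp)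
    then show False using not_AE_False_open[OF \<Omega>(1,3)] by simp
  qed
qed

text \<open>With E_ij the matrix unit, T = \<phi> E_ij has divergence (d_j \<phi>) e_i. Its normal
  trace at \<xi> adds the integrals of \<xi>_i d_j \<phi> and of \<phi> d_j \<xi>_i, and this sum
  vanishes by the definition of the weak gradient.\<close>

lemma single_entry_test_field:
  fixes \<Omega> :: "(real^'n) set" and i j :: 'n
  defines "T \<equiv> \<lambda>\<phi> x. \<phi> x *\<^sub>R axis i (axis j 1) :: real^'n^'n"
  assumes \<Omega>: "open \<Omega>" "bounded \<Omega>" and p: "1 < p" and \<phi>: "\<phi> \<in> test_functions \<Omega>"
  shows "T \<phi> \<in> Sigma_p0 \<Omega> p"
    and "\<And>\<xi>. \<xi> \<in> W1_vec \<Omega> q \<Longrightarrow>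
      pair \<Omega> (wdiv_mat \<Omega> (T \<phi>)) \<xi> = (\<integral>x. \<xi> x $ i * classical_grad \<phi> x $ j \<partial>lebesgue_on \<Omega>)"
proof -
  have meas: "\<Omega> \<in> sets lebesgue" using \<Omega>(1) by auto
  define d where "d k x = (if k = i then classical_grad \<phi> x $ j else 0)" for k x
  have d_cont: "continuous_on UNIV (d k)" for k
    using test_functionsD(4)[OF \<phi>] by (cases "k = i") (auto simp: d_def[abs_def])
  have weak: "has_weak_div \<Omega> (\<lambda>x. T \<phi> x $ k) (d k)" for k
  proof (cases "k = i")
    case True
    then show ?thesis
      using has_weak_div_smooth_axis[OF meas test_functionsD(1)[OF \<phi>], of j] by (simp add: T_def d_def[abs_def])
  next
    case False
    \<comment> \<open>All other rows are zero; they are the smooth case with the constant function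
      0.\<close>
    have "has_weak_div \<Omega> (\<lambda>x. 0 *\<^sub>R axis j 1) (\<lambda>x. classical_grad (\<lambda>x. 0) x $ j)"
      by (rule has_weak_div_smooth_axis[OF meas Ck_const])
    with False show ?thesis by (simp add: T_def d_def[abs_def] axis_def)
  qed
  have "T \<phi> \<in> Lp \<Omega> p"
    unfolding T_def using p test_functionsD(2)[OF \<phi>]
    by (intro Lp_continuous[OF meas \<Omega>(2)] continuous_on_scaleR) auto
  moreover have "d k \<in> Lp \<Omega> p" for k
    using p by (intro Lp_continuous[OF meas \<Omega>(2) d_cont]) auto
  ultimately have Sigma: "T \<phi> \<in> Sigma_p \<Omega> p"
    using weak by (auto simp: Sigma_p_def)
  have AE: "AE x in lebesgue_on \<Omega>. wdiv_mat \<Omega> (T \<phi>) x = (\<chi> k. d k x)"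
  proof -
    have "AE x in lebesgue_on \<Omega>. \<forall>k\<in>UNIV. wdiv_mat \<Omega> (T \<phi>) x $ k = d k x"
      using wdiv_AE_eq[OF \<Omega>(1) weak] by (intro AE_finite_allI) (auto simp: wdiv_mat_def)
    then show ?thesis by (simp add: vec_eq_iff)
  qed
  have inner: "(\<chi> k. d k x) \<bullet> \<xi> = \<xi> $ i * classical_grad \<phi> x $ j" for x \<xi>
    by (subst mult.commute) (simp add: inner_vec_def d_def if_distrib[of "\<lambda>a. a * _"] cong: if_cong)
  show div: "pair \<Omega> (wdiv_mat \<Omega> (T \<phi>)) \<xi> = (\<integral>x. \<xi> x $ i * classical_grad \<phi> x $ j \<partial>lebesgue_on \<Omega>)"
    if \<xi>: "\<xi> \<in> W1_vec \<Omega> q" for \<xi> q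
  proof -
    have d_meas: "(\<lambda>x. \<chi> k. d k x) \<in> borel_measurable (lebesgue_on \<Omega>)"
      using d_cont by (intro LpD(1)[OF Lp_continuous[OF meas \<Omega>(2), where p = 1]] continuous_on_vec_lambda) auto
    have eq: "AE x in lebesgue_on \<Omega>. (\<chi> k. d k x) = wdiv_mat \<Omega> (T \<phi>) x"
      using AE by eventually_elim simp
    have \<xi>_meas: "\<xi> \<in> borel_measurable (lebesgue_on \<Omega>)"
    proof -
      have "(\<lambda>x. \<Sum>k\<in>UNIV. (\<xi> x $ k) *\<^sub>R (axis k 1 :: real^'n)) \<in> borel_measurable (lebesgue_on \<Omega>)"
        using \<xi> by (intro borel_measurable_sum borel_measurable_scaleR) (auto simp: W1_vec_def W1_def Lp_def)
      then show ?thesis by (simp add: basis_expansion scalar_mult_eq_scaleR[symmetric])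
    qed
    have "pair \<Omega> (wdiv_mat \<Omega> (T \<phi>)) \<xi> = (\<integral>x. (\<chi> k. d k x) \<bullet> \<xi> x \<partial>lebesgue_on \<Omega>)"
      unfolding pair_def
    proof (rule integral_cong_AE)
      show "(\<lambda>x. wdiv_mat \<Omega> (T \<phi>) x \<bullet> \<xi> x) \<in> borel_measurable (lebesgue_on \<Omega>)"
        using borel_measurable_lebesgue_on_AE[OF meas d_meas eq] \<xi>_meas by (rule borel_measurable_inner)
      show "(\<lambda>x. (\<chi> k. d k x) \<bullet> \<xi> x) \<in> borel_measurable (lebesgue_on \<Omega>)"
        using d_meas \<xi>_meas by (rule borel_measurable_inner)
      show "AE x in lebesgue_on \<Omega>. wdiv_mat \<Omega> (T \<phi>) x \<bullet> \<xi> x = (\<chi> k. d k x) \<bullet> \<xi> x"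
        using AE by eventually_elim simp
    qed
    then show ?thesis by (simp add: inner)
  qed
  have "normal_trace_mat \<Omega> (T \<phi>) \<xi> = 0" if \<xi>: "\<xi> \<in> W1_vec \<Omega> (conj_exp p)" for \<xi>
  proof -
    have "has_weak_grad \<Omega> (\<lambda>x. \<xi> x $ i) (wgrad \<Omega> (\<lambda>x. \<xi> x $ i))"
      using \<xi> by (intro W1_wgrad(1)[OF \<Omega>(1)]) (auto simp: W1_vec_def)
    then have "(\<integral>x. \<xi> x $ i * classical_grad \<phi> x $ j \<partial>lebesgue_on \<Omega>)
        = - (\<integral>x. \<phi> x * wgrad \<Omega> (\<lambda>x. \<xi> x $ i) x $ j \<partial>lebesgue_on \<Omega>)"
      using \<phi> by (simp add: has_weak_grad_iff[OF meas])
    then show ?thesis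
      by (simp add: normal_trace_mat_def div[OF \<xi>]) (simp add: pair_def T_def wgrad_vec_def inner_axis')
  qed
  with Sigma show "T \<phi> \<in> Sigma_p0 \<Omega> p" by (simp add: Sigma_p0_def)
qed

text \<open>The duality map of L^p. Since (p - 1) q = p, pointwise |W|^q = |R|^p = R \<bullet> W,
  which is the equality case of Hoelder's inequality.\<close>

lemma duality_map_Lp:
  fixes R :: "real^'n \<Rightarrow> 'b::euclidean_space" and p :: real
  defines "W \<equiv> \<lambda>x. norm (R x) powr (p - 2) *\<^sub>R R x"
  assumes R: "R \<in> Lp \<Omega> p" and p: "1 < p" and q: "q = conj_exp p"
  shows "W \<in> Lp \<Omega> q" "Lnorm \<Omega> q W = (\<integral>x. norm (R x) powr p \<partial>lebesgue_on \<Omega>) powr (1 / q)"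
    "pair \<Omega> R W = (\<integral>x. norm (R x) powr p \<partial>lebesgue_on \<Omega>)"
proof -
  have normW: "norm (W x) powr q = norm (R x) powr p" for x
  proof -
    \<comment> \<open>Where R = 0 the exponent p - 2 may be negative; \<open>powr\<close> with base
      0 gives 0, so both sides vanish there.\<close>
    have "norm (W x) = norm (R x) powr (p - 1)"
      using powr_add[of "norm (R x)" "p - 2" 1] by (cases "R x = 0") (auto simp: W_def)
    then show ?thesis using conj_exp_properties(3)[OF p] q by (simp add: powr_powr)
  qed
  have inner: "R x \<bullet> W x = norm (R x) powr p" for x
    using powr_add[of "norm (R x)" "p - 2" 2]
    by (cases "R x = 0") (auto simp: W_def dot_square_norm)
  show "W \<in> Lp \<Omega> q"
    using LpD[OF R] normW by (simp add: Lp_def) (simp add: W_def)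
  show "Lnorm \<Omega> q W = (\<integral>x. norm (R x) powr p \<partial>lebesgue_on \<Omega>) powr (1 / q)"
    by (simp add: Lnorm_def normW)
  show "pair \<Omega> R W = (\<integral>x. norm (R x) powr p \<partial>lebesgue_on \<Omega>)"
    by (simp add: pair_def inner)
qed

text \<open>The equation tested with \<phi> E_ij is the (i, j) entry of the weak gradient identity
  for \<theta>; uniqueness then identifies W with the chosen gradient.\<close>

lemma multiplier_gradient:
  fixes \<Omega> :: "(real^'n) set" and R :: "real^'n \<Rightarrow> real^'n^'n" and p :: real
  defines "W \<equiv> \<lambda>x. norm (R x) powr (p - 2) *\<^sub>R R x"
  assumes \<Omega>: "open \<Omega>" "bounded \<Omega>" and p: "1 < p" and q: "q = conj_exp p"
    and R: "R \<in> Lp \<Omega> p" and \<theta>: "\<theta> \<in> W1_vec \<Omega> q"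
    and eq: "\<And>T. T \<in> Sigma_p0 \<Omega> p \<Longrightarrow> pair \<Omega> W T + pair \<Omega> (wdiv_mat \<Omega> T) \<theta> = 0"
  shows "AE x in lebesgue_on \<Omega>. wgrad_vec \<Omega> \<theta> x = W x"
proof (rule wgrad_vec_AE_eq[OF \<Omega>(1)])
  fix i
  have meas: "\<Omega> \<in> sets lebesgue" using \<Omega>(1) by auto
  have q1: "1 < q" using conj_exp_properties(1)[OF p] q by simp
  have W: "(\<lambda>x. W x $ i) \<in> Lp \<Omega> q"
    using duality_map_Lp(1)[OF R p q] q1
    by (intro Lp_bounded_linear[OF _ bounded_linear_vec_nth]) (auto simp: W_def)
  show "has_weak_grad \<Omega> (\<lambda>x. \<theta> x $ i) (\<lambda>x. W x $ i)"
    unfolding has_weak_grad_iff[OF meas]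
  proof (intro conjI ballI allI)
    have "(\<lambda>x. \<theta> x $ i) \<in> W1 \<Omega> q" using \<theta> by (simp add: W1_vec_def)
    from W1_wgrad(1)[OF \<Omega>(1) this] show "loc_integrable \<Omega> (\<lambda>x. \<theta> x $ i)"
      by (simp add: has_weak_grad_def)
    show "loc_integrable \<Omega> (\<lambda>x. W x $ i)"
      using q1 by (intro Lp_loc_integrable[OF meas \<Omega>(2) W]) simp
    show "(\<integral>x. \<theta> x $ i * classical_grad \<phi> x $ j \<partial>lebesgue_on \<Omega>) = - (\<integral>x. \<phi> x * W x $ i $ j \<partial>lebesgue_on \<Omega>)"
      if "\<phi> \<in> test_functions \<Omega>" for \<phi> j
      using eq[OF single_entry_test_field(1)[OF \<Omega> p that, of i j]] single_entry_test_field(2)[OF \<Omega> p that \<theta>, of i j]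
      by (simp add: pair_def inner_axis)
  qed
qed

section \<open>Weak duality and attainment of the supremum at the reversed multiplier\<close>

theorem theorem3p4:
  fixes \<Omega> :: "(real^'n) set"
    and f u y :: "real^'n \<Rightarrow> real"
    and j :: "real \<Rightarrow> real"
    and p q :: real
    and S :: "real^'n \<Rightarrow> real^'n^'n"
    and \<theta> :: "real^'n \<Rightarrow> real^'n"
  assumes dim: "CARD('n) = 2 \<or> CARD('n) = 3"
    and domain: "bounded_lipschitz_domain \<Omega>"
    and j_diff: "\<And>t. j differentiable (at t)"
    and j_L1: "\<And>v. v \<in> H10 \<Omega> \<Longrightarrow> (\<lambda>x. j (v x)) \<in> Lp \<Omega> 1"
    and j'_L2: "\<And>v. v \<in> H10 \<Omega> \<Longrightarrow> (\<lambda>x. deriv j (v x)) \<in> Lp \<Omega> 2"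
    and state: "is_state \<Omega> f u"
    and adjoint: "is_adjoint_state \<Omega> j u y"
    and p: "1 < p" "p \<le> 2"
    and q: "q = conj_exp p"
    and helmholtz: "helmholtz_decomposition \<Omega> q"
    and K_Lp: "shape_tensor \<Omega> u y \<in> Lp \<Omega> p"
    and f_Linf: "f \<in> Linf \<Omega>"
    and ju_L2: "(\<lambda>x. j (u x)) \<in> Lp \<Omega> 2"
    and compatibility: "\<And>e :: real^'n. pair \<Omega> (\<lambda>x. f x *\<^sub>R wgrad \<Omega> y x) (\<lambda>x. e) = 0"
    and S: "S \<in> Sigma_p0 \<Omega> p"
    and \<theta>: "\<theta> \<in> W1_vec \<Omega> q"
    and eq1: "\<And>T. T \<in> Sigma_p0 \<Omega> p \<Longrightarrow>
        pair \<Omega> (\<lambda>x. norm (S x - shape_tensor \<Omega> u y x) powr (p - 2) *\<^sub>R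
                      (S x - shape_tensor \<Omega> u y x)) T
          + pair \<Omega> (wdiv_mat \<Omega> T) \<theta> = 0"
    and eq2: "\<And>\<xi>. \<xi> \<in> W1_vec \<Omega> q \<Longrightarrow>
        pair \<Omega> (wdiv_mat \<Omega> S) \<xi> - pair \<Omega> (\<lambda>x. f x *\<^sub>R wgrad \<Omega> y x) \<xi>
          - pair \<Omega> (\<lambda>x. j (u x)) (wdiv \<Omega> \<xi>) = 0"
  shows "(\<not> (AE x in lebesgue_on \<Omega>. wgrad_vec \<Omega> \<theta> x = 0) \<longrightarrow>
            ereal (- shape_derivative \<Omega> f j u y \<theta> / Lnorm \<Omega> q (wgrad_vec \<Omega> \<theta>)) =
            (SUP \<xi> \<in> {\<xi> \<in> W1_vec \<Omega> q. \<not> (AE x in lebesgue_on \<Omega>. wgrad_vec \<Omega> \<xi> x = 0)}.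
               ereal (shape_derivative \<Omega> f j u y \<xi> / Lnorm \<Omega> q (wgrad_vec \<Omega> \<xi>))))
       \<and> (SUP \<xi> \<in> {\<xi> \<in> W1_vec \<Omega> q. \<not> (AE x in lebesgue_on \<Omega>. wgrad_vec \<Omega> \<xi> x = 0)}.
             ereal (shape_derivative \<Omega> f j u y \<xi> / Lnorm \<Omega> q (wgrad_vec \<Omega> \<xi>)))
         = eta_p \<Omega> f j u y p"
proof -
  define K where "K = shape_tensor \<Omega> u y"
  define R where "R x = S x - K x" for x
  define N where "N \<xi> = Lnorm \<Omega> q (wgrad_vec \<Omega> \<xi>)" for \<xi>
  define J where "J = shape_derivative \<Omega> f j u y"
  \<comment> \<open>All quantities turn out to be powers of A: R has norm A^(1/p), the gradient of
    \<theta> has norm A^(1/q), and the shape derivative at \<theta> is -A.\<close>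
  define A where "A = (\<integral>x. norm (R x) powr p \<partial>lebesgue_on \<Omega>)"
  define admissible where "admissible = {T \<in> Sigma_p0 \<Omega> p. \<forall>\<xi>\<in>W1_vec \<Omega> q. pair \<Omega> (wdiv_mat \<Omega> T) \<xi> =
      pair \<Omega> (\<lambda>x. f x *\<^sub>R wgrad \<Omega> y x) \<xi> + pair \<Omega> (\<lambda>x. j (u x)) (wdiv \<Omega> \<xi>)}"
  define X where "X = {\<xi> \<in> W1_vec \<Omega> q. \<not> (AE x in lebesgue_on \<Omega>. wgrad_vec \<Omega> \<xi> x = 0)}"
  define sup where "sup = (SUP \<xi>\<in>X. ereal (J \<xi> / N \<xi>))"
  have \<Omega>: "open \<Omega>" "bounded \<Omega>" "\<Omega> \<noteq> {}" using domain by (auto simp: bounded_lipschitz_domain_def)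
  have q1: "1 < q" and pq: "1 / p + 1 / q = 1" using conj_exp_properties[OF p(1)] q by auto
  have K: "K \<in> Lp \<Omega> p" using K_Lp by (simp add: K_def)
  have T_Lp: "T \<in> Lp \<Omega> p" if "T \<in> Sigma_p0 \<Omega> p" for T
    using that by (simp add: Sigma_p0_def Sigma_p_def)
  have TK: "(\<lambda>x. T x - K x) \<in> Lp \<Omega> p" if "T \<in> Sigma_p0 \<Omega> p" for T
    using Lp_diff[OF T_Lp[OF that] K] p by simp
  have G: "wgrad_vec \<Omega> \<xi> \<in> Lp \<Omega> q" if "\<xi> \<in> W1_vec \<Omega> q" for \<xi>
    using wgrad_vec_Lp[OF \<Omega>(1) that] q1 by simp
  \<comment> \<open>The left side does not mention T: one functional is represented by every
    admissible T, which lets the bound on the quotients be taken over all of them.\<close>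
  have J_eq: "J \<xi> = - pair \<Omega> (\<lambda>x. T x - K x) (wgrad_vec \<Omega> \<xi>)"
    if T: "T \<in> admissible" and \<xi>: "\<xi> \<in> W1_vec \<Omega> q" for T \<xi>
  proof -
    have T0: "T \<in> Sigma_p0 \<Omega> p" using T by (simp add: admissible_def)
    have "pair \<Omega> (\<lambda>x. T x - K x) (wgrad_vec \<Omega> \<xi>) = pair \<Omega> T (wgrad_vec \<Omega> \<xi>) - pair \<Omega> K (wgrad_vec \<Omega> \<xi>)"
      using Holder(1)[OF T_Lp[OF T0] G[OF \<xi>] p(1) q] Holder(1)[OF K G[OF \<xi>] p(1) q]
      by (simp add: pair_def inner_diff_left)
    moreover have "pair \<Omega> (wdiv_mat \<Omega> T) \<xi> + pair \<Omega> T (wgrad_vec \<Omega> \<xi>) = 0"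
      using T0 \<xi> by (simp add: Sigma_p0_def normal_trace_mat_def q)
    moreover have "pair \<Omega> (wdiv_mat \<Omega> T) \<xi> =
        pair \<Omega> (\<lambda>x. f x *\<^sub>R wgrad \<Omega> y x) \<xi> + pair \<Omega> (\<lambda>x. j (u x)) (wdiv \<Omega> \<xi>)"
      using T \<xi> by (simp add: admissible_def)
    ultimately show ?thesis by (simp add: J_def shape_derivative_def K_def)
  qed
  have N_pos: "0 < N \<xi>" if "\<xi> \<in> X" for \<xi>
    using that Lnorm_eq_0_iff[OF G] Lnorm_nonneg[of \<Omega> q "wgrad_vec \<Omega> \<xi>"]
    by (auto simp: X_def N_def less_le)
  have S_adm: "S \<in> admissible" using S eq2 by (auto simp: admissible_def algebra_simps)
  have eta: "eta_p \<Omega> f j u y p = (INF T\<in>admissible. ereal (Lnorm \<Omega> p (\<lambda>x. T x - K x)))"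
    by (simp add: eta_p_def admissible_def K_def q)
  \<comment> \<open>Weak duality: each quotient is bounded by each admissible distance.\<close>
  have sup_le: "sup \<le> eta_p \<Omega> f j u y p"
    unfolding sup_def eta
  proof (intro SUP_least INF_greatest)
    fix \<xi> T assume \<xi>: "\<xi> \<in> X" and T: "T \<in> admissible"
    have "J \<xi> \<le> Lnorm \<Omega> p (\<lambda>x. T x - K x) * N \<xi>"
      using J_eq[OF T, of \<xi>] Holder(2)[OF TK[of T] G[of \<xi>] p(1) q] \<xi> T
      by (simp add: X_def admissible_def N_def)
    then show "ereal (J \<xi> / N \<xi>) \<le> ereal (Lnorm \<Omega> p (\<lambda>x. T x - K x))"
      using N_pos[OF \<xi>] by (simp add: pos_divide_le_eq)
  qed
  have eta_le: "eta_p \<Omega> f j u y p \<le> ereal (Lnorm \<Omega> p R)"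
    unfolding eta R_def[abs_def] by (rule INF_lower[OF S_adm])
  have R: "R \<in> Lp \<Omega> p" using TK[OF S] by (simp add: R_def[abs_def])
  let ?W = "\<lambda>x. norm (R x) powr (p - 2) *\<^sub>R R x"
  note W = duality_map_Lp[OF R p(1) q, folded A_def]
  have grad: "AE x in lebesgue_on \<Omega>. wgrad_vec \<Omega> \<theta> x = ?W x"
    using eq1 by (intro multiplier_gradient[OF \<Omega>(1,2) p(1) q R \<theta>]) (simp add: R_def K_def)
  note Gm = LpD(1)[OF G[OF \<theta>]] and Wm = LpD(1)[OF W(1)] and Rm = LpD(1)[OF R]
  have N\<theta>: "N \<theta> = A powr (1 / q)"
    unfolding N_def W(2)[symmetric]
    by (rule Lnorm_cong_AE[OF Gm Wm]) (use grad in \<open>auto elim: eventually_mono\<close>)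
  have J\<theta>: "J \<theta> = - A"
    using J_eq[OF S_adm \<theta>] pair_cong_AE[OF Rm Gm Wm grad] W(3) by (simp add: R_def[abs_def])
  have LR: "Lnorm \<Omega> p R = A powr (1 / p)" by (simp add: Lnorm_def A_def)
  have A0: "0 \<le> A" by (simp add: A_def)
  \<comment> \<open>With 1/p + 1/q = 1, dividing A by A^(1/q) leaves A^(1/p).\<close>
  have ratio: "- J \<theta> / N \<theta> = Lnorm \<Omega> p R" if "A \<noteq> 0"
  proof -
    have "A powr (1 / p) * A powr (1 / q) = A"
      using that A0 pq by (simp flip: powr_add)
    then show ?thesis using that A0 by (simp add: J\<theta> N\<theta> LR field_simps)
  qed
  have le_sup: "ereal (Lnorm \<Omega> p R) \<le> sup"
  proof (cases "A = 0")
    case True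
    \<comment> \<open>All quotients vanish, but the supremum over an empty set would be \<open>-\<infinity>\<close>.\<close>
    let ?\<xi> = "\<lambda>x::real^'n. x"
    have \<xi>: "?\<xi> \<in> X" using identity_W1_vec[OF \<Omega>, of q] q1 by (simp add: X_def)
    have "\<bar>J ?\<xi>\<bar> \<le> Lnorm \<Omega> p R * N ?\<xi>"
      using J_eq[OF S_adm, of ?\<xi>] Holder(2)[OF R G[of ?\<xi>] p(1) q] \<xi>
      by (simp add: X_def R_def[abs_def] N_def)
    then have "ereal (Lnorm \<Omega> p R) = ereal (J ?\<xi> / N ?\<xi>)" using True p by (simp add: LR)
    also have "\<dots> \<le> sup" unfolding sup_def by (rule SUP_upper[OF \<xi>])
    finally show ?thesis .
  next
    case False
    \<comment> \<open>The equality case of Hoelder has the wrong sign at \<theta>, where the shape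
      derivative is -A < 0; reversing the field makes the quotient positive.\<close>
    let ?\<xi> = "\<lambda>x. - \<theta> x"
    have \<xi>: "?\<xi> \<in> W1_vec \<Omega> q" and AE: "AE x in lebesgue_on \<Omega>. wgrad_vec \<Omega> ?\<xi> x = - wgrad_vec \<Omega> \<theta> x"
      using W1_vec_uminus[OF \<Omega>(1) \<theta>] q1 by auto
    note Gm' = LpD(1)[OF G[OF \<xi>]]
    have N_eq: "N ?\<xi> = N \<theta>"
      unfolding N_def by (rule Lnorm_cong_AE[OF Gm' Gm]) (use AE in \<open>auto elim: eventually_mono\<close>)
    have "pair \<Omega> R (wgrad_vec \<Omega> ?\<xi>) = pair \<Omega> R (\<lambda>x. - wgrad_vec \<Omega> \<theta> x)"
      by (rule pair_cong_AE[OF Rm Gm' _ AE]) (use Gm in simp)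
    then have "J ?\<xi> = - J \<theta>"
      using J_eq[OF S_adm \<xi>] J_eq[OF S_adm \<theta>] by (simp add: R_def[abs_def] pair_def)
    with N_eq ratio[OF False] have eq: "ereal (Lnorm \<Omega> p R) = ereal (J ?\<xi> / N ?\<xi>)" by simp
    have "N ?\<xi> \<noteq> 0" using False N_eq N\<theta> by simp
    then have "?\<xi> \<in> X" using \<xi> Lnorm_eq_0_iff[OF G[OF \<xi>]] by (simp add: X_def N_def)
    then show ?thesis unfolding sup_def eq by (rule SUP_upper)
  qed
  \<comment> \<open>The circle closes: supremum \<le> infimum \<le> norm of R \<le>
    supremum.\<close>
  have sup_eq: "sup = ereal (Lnorm \<Omega> p R)" "sup = eta_p \<Omega> f j u y p"
    using sup_le eta_le le_sup by auto
  \<comment> \<open>A nonzero gradient excludes A = 0, since the gradient norm of \<theta> is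
    A^(1/q).\<close>
  have "ereal (- J \<theta> / N \<theta>) = sup" if "\<not> (AE x in lebesgue_on \<Omega>. wgrad_vec \<Omega> \<theta> x = 0)"
  proof -
    have "N \<theta> \<noteq> 0" using that Lnorm_eq_0_iff[OF G[OF \<theta>]] by (simp add: N_def)
    then have "A \<noteq> 0" using N\<theta> by auto
    then show ?thesis using ratio sup_eq by simp
  qed
  with sup_eq(2) show ?thesis
    unfolding sup_def X_def J_def N_def by blast
qed

end
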